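(* Let $[X,d,m]$ be a metric random walk space with invariant and reversible probability measure $\nu$, and assume $\Theta_m<\infty$. If the Ollivier-Ricci curvature satisfies $\kappa_m>0$, then $$W_1^d(\mu,\nu)\le\frac{\sqrt{2\Theta_m}}{\kappa_m}\sqrt{I_\nu(\mu)}\qquad\text{for all probability measures }\mu\ll\nu.$$
   Context: A metric random walk space $[X,d,m]$ is a Polish metric space $(X,d)$ with a family $m=(m_x)_{x\in X}$ of Borel probability measures, $x\mapsto m_x(A)$ Borel measurable, each with finite first moment. A Radon measure $\nu$ is invariant if $\nu(A)=\int_X m_x(A)d\nu(x)$ for all $\nu$-measurable $A$, reversible if $dm_x(y)d\nu(x)=dm_y(x)d\nu(y)$. $W_1^d$ is the $1$-Wasserstein distance: $W_1^d(\mu,\mu')=\inf_\gamma\int d(x,y)\,d\gamma$ over couplings $\gamma$ of $\mu,\mu'$. Ollivier-Ricci curvature: $\kappa_m=\inf_{x\ne y}\big(1-W_1^d(m_x,m_y)/d(x,y)\big)$. $\Theta_m=\operatorname{ess\,sup}_{x\in X}\frac12\int_X d(x,y)^2dm_x(y)$. $\mathcal H_m(f)=\frac12\iint(f(y)-f(x))^2dm_x(y)d\nu(x)$; $I_\nu(\mu)=2\mathcal H_m(\sqrt f)$ if $\mu=f\nu$, $f\ge0$, and $+\infty$ otherwise. *)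

theory Defs
  imports "HOL-Probability.Probability"
begin

definition mrw_space :: "('a::polish_space \<Rightarrow> 'a measure) \<Rightarrow> bool" where
  "mrw_space m \<longleftrightarrow>
     (\<forall>x. prob_space (m x) \<and> sets (m x) = sets borel) \<and>
     (\<forall>A \<in> sets borel. (\<lambda>x. emeasure (m x) A) \<in> borel_measurable borel) \<and>
     (\<forall>x. integrable (m x) (\<lambda>y. dist x y))"

definition invariant_measure :: "('a::polish_space \<Rightarrow> 'a measure) \<Rightarrow> 'a measure \<Rightarrow> bool" where
  "invariant_measure m \<nu> \<longleftrightarrow>
     sets \<nu> = sets borel \<and>
     (\<forall>A \<in> sets borel. emeasure \<nu> A = (\<integral>\<^sup>+ x. emeasure (m x) A \<partial>\<nu>))"

definition reversible_measure :: "('a::polish_space \<Rightarrow> 'a measure) \<Rightarrow> 'a measure \<Rightarrow> bool" where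
  "reversible_measure m \<nu> \<longleftrightarrow>
     sets \<nu> = sets borel \<and>
     (\<forall>C \<in> sets (borel \<Otimes>\<^sub>M borel).
        (\<integral>\<^sup>+ x. (\<integral>\<^sup>+ y. indicator C (x, y) \<partial>m x) \<partial>\<nu>)
      = (\<integral>\<^sup>+ x. (\<integral>\<^sup>+ y. indicator C (y, x) \<partial>m x) \<partial>\<nu>))"

definition couplings :: "'a::polish_space measure \<Rightarrow> 'a measure \<Rightarrow> ('a \<times> 'a) measure set" where
  "couplings \<mu> \<mu>' = {\<gamma>. sets \<gamma> = sets (borel \<Otimes>\<^sub>M borel) \<and>
       distr \<gamma> borel fst = \<mu> \<and> distr \<gamma> borel snd = \<mu>'}"

definition W1 :: "'a::polish_space measure \<Rightarrow> 'a measure \<Rightarrow> ereal" where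
  "W1 \<mu> \<mu>' = enn2ereal (INF \<gamma> \<in> couplings \<mu> \<mu>'. \<integral>\<^sup>+ p. ennreal (dist (fst p) (snd p)) \<partial>\<gamma>)"

definition ricci_curv :: "('a::polish_space \<Rightarrow> 'a measure) \<Rightarrow> ereal" where
  "ricci_curv m = (INF p \<in> {p. fst p \<noteq> snd p}.
       1 - W1 (m (fst p)) (m (snd p)) / ereal (dist (fst p) (snd p)))"

definition Theta :: "('a::polish_space \<Rightarrow> 'a measure) \<Rightarrow> 'a measure \<Rightarrow> ereal" where
  "Theta m \<nu> = esssup \<nu> (\<lambda>x. enn2ereal ((1/2) * (\<integral>\<^sup>+ y. ennreal ((dist x y)\<^sup>2) \<partial>m x)))"

definition H_energy :: "('a::polish_space \<Rightarrow> 'a measure) \<Rightarrow> 'a measure \<Rightarrow> ('a \<Rightarrow> real) \<Rightarrow> ennreal" where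
  "H_energy m \<nu> f = (1/2) * (\<integral>\<^sup>+ x. (\<integral>\<^sup>+ y. ennreal ((f y - f x)\<^sup>2) \<partial>m x) \<partial>\<nu>)"

definition fisher_info :: "('a::polish_space \<Rightarrow> 'a measure) \<Rightarrow> 'a measure \<Rightarrow> 'a measure \<Rightarrow> ennreal" where
  "fisher_info m \<nu> \<mu> =
     (if \<exists>f \<in> borel_measurable \<nu>. \<mu> = density \<nu> f
      then 2 * H_energy m \<nu> (\<lambda>x. sqrt (enn2real (RN_deriv \<nu> \<mu> x)))
      else \<infinity>)"

definition esqrt :: "ereal \<Rightarrow> ereal" where
  "esqrt x = (if x = \<infinity> then \<infinity> else ereal (sqrt (max 0 (real_of_ereal x))))"

end

(* Let P be the averaging operator of the walk, mu = f nu, and K = sqrt (2 Theta I(mu)).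
   For a 1-Lipschitz phi, reversibility gives
     int phi dmu - int P phi dmu = 1/2 int int (f x - f y) (phi x - phi y) dm_x(y) dnu(x).
   Writing f x - f y = (sqrt (f x) - sqrt (f y)) (sqrt (f x) + sqrt (f y)) and applying Cauchy-Schwarz
   bounds this by K. By the curvature hypothesis P maps L-Lipschitz functions to (1 - kappa) L-Lipschitz
   ones, and nu is P-invariant; iterating phi -> P phi therefore gives
   int phi dmu - int phi dnu <= K (1 + (1 - kappa) + (1 - kappa)^2 + ...) = K / kappa.
   Kantorovich-Rubinstein duality turns this into the bound on W1. The duality is obtained by
   discretising the space and solving a finite transport problem, where an optimal plan is cyclically
   monotone and the potential is an infimum over chains. *)

theory Submission
  imports Defs
begin

section \<open>Finite transport problems\<close>

text \<open>Neither \<open>\<mu>\<close> nor \<open>\<nu>\<close> comes with a finite first moment,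
  so W1 might a priori be infinite, and n steps of the iteration leave a remainder (1 - kappa)^n R
  whose R might be infinite too. This shapes the proof: drift and duality are tested on bounded
  Lipschitz functions only, and finite moments are derived from the drift inequality itself, since
  under contraction the distance to a fixed point is a Lyapunov function. The measure
  \<open>\<nu>\<close> passes through the same lemmas as \<open>\<mu>\<close>: it has density 1,
  energy 0 and hence drift 0. The constant: Cauchy-Schwarz pairs I with the integral of (sqrt (f x)
  + sqrt (f y))^2 d(x, y)^2. By (sqrt a + sqrt b)^2 \<le> 2 a + 2 b and second moments of at most 2
  Theta, that integral is at most 8 Theta; the 1/2 of the symmetrisation turns sqrt (8 Theta I) into
  sqrt (2 Theta I). In the duality a finite-valued map moves both measures by little in mean; a plan
  between the images is spread back over the cells of the map, so optimal couplings are needed on a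
  finite set only.\<close>

text \<open>The alternating sum of \<^term>\<open>h\<close> along a chain of plan edges \<^term>\<open>(a, b)\<close>. Closing it up
  at \<^term>\<open>b\<close> gives the cyclic sums of cyclical monotonicity; it is written for a general \<^term>\<open>h\<close>
  because \<^term>\<open>h\<close> ranging over indicators yields the mass rearrangement along the cycle.\<close>

fun chain :: "('a \<Rightarrow> 'a \<Rightarrow> real) \<Rightarrow> 'a \<Rightarrow> ('a \<times> 'a) list \<Rightarrow> 'a \<Rightarrow> real" where
  "chain h x [] e = h x e"
| "chain h x ((a, b) # l) e = h x b - h a b + chain h a l e"

lemma chain_fst: "chain (\<lambda>x y. \<phi> x) x l e = \<phi> x"
  by (induction l arbitrary: x) auto

lemma chain_snd: "chain (\<lambda>x y. \<psi> y) x l e = \<psi> e"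
  by (induction l arbitrary: x) auto

lemma chain_sum: "finite J \<Longrightarrow> chain (\<lambda>x y. \<Sum>j\<in>J. h j x y) x l e = (\<Sum>j\<in>J. chain (h j) x l e)"
  by (induction l arbitrary: x) (auto simp: sum.distrib sum_subtractf)

lemma chain_mult: "chain (\<lambda>x y. c * h x y) x l e = c * chain h x l e"
  by (induction l arbitrary: x) (auto simp: algebra_simps)

lemma chain_cong:
  assumes "\<And>x y. x \<in> Z \<Longrightarrow> y \<in> Z \<Longrightarrow> h x y = h' x y" "x \<in> Z" "e \<in> Z" "set l \<subseteq> Z \<times> Z"
  shows "chain h x l e = chain h' x l e"
  using assms by (induction l arbitrary: x) auto

text \<open>The bound counts the negative terms, one for each listed pair. For the indicator of a
  pair it limits how much mass one turn around the cycle can take away there.\<close>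

lemma chain_lower:
  assumes "\<And>x y. 0 \<le> h x y" "\<And>x y. h x y \<le> 1"
  shows "- real (length l) \<le> chain h x l e"
proof (induction l arbitrary: x)
  case Nil
  then show ?case using assms by simp
next
  case (Cons p l)
  obtain a b where p: "p = (a, b)" by fastforce
  have "h a b \<le> 1" "0 \<le> h x b" "- real (length l) \<le> chain h a l e"
    using assms Cons by auto
  then show ?case by (simp add: p)
qed

text \<open>The negative terms vanish by the second premise. It serves for the indicator of a pair
  off the cycle, where mass can only be gained.\<close>

lemma chain_nonneg:
  assumes "\<And>x y. 0 \<le> h x y" "\<And>a b. (a, b) \<in> set l \<Longrightarrow> h a b = 0"
  shows "0 \<le> chain h x l e"
  using assms by (induction l arbitrary: x) auto

text \<open>Plans are total functions forced to vanish off \<open>Z \<times> Z\<close>. They thus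
  live in the product topology on real functions, and compactness needs no enumeration of
  \<open>Z\<close>.\<close>

definition transport_plans :: "'a set \<Rightarrow> ('a \<Rightarrow> real) \<Rightarrow> ('a \<Rightarrow> real) \<Rightarrow> ('a \<times> 'a \<Rightarrow> real) set" where
  "transport_plans Z p q = {w. (\<forall>z. 0 \<le> w z) \<and> (\<forall>z. z \<notin> Z \<times> Z \<longrightarrow> w z = 0) \<and>
     (\<forall>a\<in>Z. (\<Sum>b\<in>Z. w (a, b)) = p a) \<and> (\<forall>b\<in>Z. (\<Sum>a\<in>Z. w (a, b)) = q b)}"

lemma transport_plansD:
  assumes "w \<in> transport_plans Z p q"
  shows "0 \<le> w z" "z \<notin> Z \<times> Z \<Longrightarrow> w z = 0"
    "a \<in> Z \<Longrightarrow> (\<Sum>b\<in>Z. w (a, b)) = p a" "b \<in> Z \<Longrightarrow> (\<Sum>a\<in>Z. w (a, b)) = q b"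
  using assms unfolding transport_plans_def by blast+

lemma transport_plans_le_sum:
  assumes "finite Z" "w \<in> transport_plans Z p q" "\<And>a. 0 \<le> p a"
  shows "w z \<le> sum p Z"
proof (cases "z \<in> Z \<times> Z")
  case True
  then obtain a b where z: "z = (a, b)" "a \<in> Z" "b \<in> Z" by auto
  have "w (a, b) \<le> (\<Sum>b\<in>Z. w (a, b))"
    using assms z by (intro member_le_sum) (auto simp: transport_plans_def)
  also have "\<dots> = p a" using assms z by (auto simp: transport_plans_def)
  also have "\<dots> \<le> sum p Z" using assms z by (intro member_le_sum) auto
  finally show ?thesis using z by simp
next
  case False
  then have "w z = 0" using assms(2) by (cases z) (simp add: transport_plans_def)
  then show ?thesis using assms(3) by (simp add: sum_nonneg)
qed

text \<open>Each constraint involves finitely many coordinates and is therefore closed; every entry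
  is at most the total mass, so the plans lie in a cube that is compact by Tychonoff.\<close>

lemma compact_transport_plans:
  assumes "finite Z" "\<And>a. 0 \<le> p a"
  shows "compact (transport_plans Z p q)"
proof -
  let ?c = "sum p Z"
  have cont: "continuous_on UNIV (\<lambda>w :: 'a \<times> 'a \<Rightarrow> real. w z)" for z
    by (rule continuous_on_product_coordinates)
  have box: "compact (PiE UNIV (\<lambda>_. {0..?c}) :: ('a \<times> 'a \<Rightarrow> real) set)"
  proof -
    have "compactin (product_topology (\<lambda>_::'a\<times>'a. euclidean::real topology) UNIV) (PiE UNIV (\<lambda>_. {0..?c}))"
      by (subst compactin_PiE) auto
    then show ?thesis by (simp add: euclidean_product_topology)
  qed
  have eq: "transport_plans Z p q = (\<Inter>z. {w. 0 \<le> w z}) \<inter> (\<Inter>z\<in>- (Z \<times> Z). {w. w z = 0}) \<inter>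
      (\<Inter>a\<in>Z. {w. (\<Sum>b\<in>Z. w (a, b)) = p a}) \<inter> (\<Inter>b\<in>Z. {w. (\<Sum>a\<in>Z. w (a, b)) = q b})"
    by (auto simp: transport_plans_def)
  have "closed (transport_plans Z p q)"
    unfolding eq
    by (intro closed_Int closed_INT ballI closed_Collect_eq closed_Collect_le
        continuous_on_sum cont continuous_on_const)
  moreover have "transport_plans Z p q \<subseteq> PiE UNIV (\<lambda>_. {0..?c})"
    using transport_plans_le_sum[OF assms(1) _ assms(2)] transport_plansD(1) by (intro subsetI PiE_I) auto
  ultimately show ?thesis
    using compact_Int_closed[OF box] by (metis inf.absorb2)
qed

lemma transport_plans_nonempty:
  assumes "finite Z" "\<And>a. 0 \<le> p a" "\<And>a. 0 \<le> q a" "sum p Z = 1" "sum q Z = 1"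
  shows "transport_plans Z p q \<noteq> {}"
proof -
  have "(\<lambda>(a, b). if a \<in> Z \<and> b \<in> Z then p a * q b else 0) \<in> transport_plans Z p q"
    using assms by (auto simp: transport_plans_def simp flip: sum_distrib_left sum_distrib_right)
  then show ?thesis by blast
qed

text \<open>Perturbation of the optimum: the right side sends each source on the cycle to the target
  of the next pair. If that were cheaper, rerouting a little mass in this way would give a plan
  cheaper than \<open>w\<close>.\<close>

lemma optimal_plan_cyclically_monotone:
  fixes h :: "'a \<Rightarrow> 'a \<Rightarrow> real"
  assumes Z: "finite Z" and w: "w \<in> transport_plans Z p q"
    and opt: "\<And>v. v \<in> transport_plans Z p q \<Longrightarrow>
      (\<Sum>z\<in>Z\<times>Z. w z * h (fst z) (snd z)) \<le> (\<Sum>z\<in>Z\<times>Z. v z * h (fst z) (snd z))"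
    and l: "set ((a, b) # l) \<subseteq> {z. 0 < w z}"
  shows "h a b \<le> chain h a l b"
proof -
  let ?L = "\<lambda>h. chain h a l b - h a b :: real"
  \<comment> \<open>\<open>\<delta> z\<close> is the indicator of the single pair \<open>z\<close>
    in the shape of a cost, so \<open>?L (\<delta> z)\<close> is the net amount that one unit sent
    around the cycle adds at \<open>z\<close>.\<close>
  define \<delta> where "\<delta> = (\<lambda>z (x::'a) (y::'a). if (x, y) = z then 1 else 0 :: real)"
  define S where "S = set ((a, b) # l)"
  have SZ: "S \<subseteq> Z \<times> Z"
  proof
    fix z assume "z \<in> S"
    then have "0 < w z" using l unfolding S_def by blast
    then have "w z \<noteq> 0" by simp
    then show "z \<in> Z \<times> Z" using w unfolding transport_plans_def by blast
  qed
  then have ab: "a \<in> Z" "b \<in> Z" and lZ: "set l \<subseteq> Z \<times> Z" by (auto simp: S_def)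
  \<comment> \<open>A pair may be listed several times and so lose up to \<open>1 + length l\<close>
    units; with this \<open>e\<close> the loss never exceeds the smallest mass on the cycle.\<close>
  define e where "e = Min (w ` S) / (1 + real (length l))"
  have "0 < Min (w ` S)" using l by (subst Min_gr_iff) (auto simp: S_def)
  then have e0: "0 < e" by (simp add: e_def)
  \<comment> \<open>\<open>?L\<close> is linear in the cost and sees it only on
    \<open>Z \<times> Z\<close>, so it expands in indicators. The change of any linear functional of
    the plan, each marginal and the total cost included, can be read off from this.\<close>
  have lin: "?L k = (\<Sum>z\<in>Z\<times>Z. k (fst z) (snd z) * ?L (\<delta> z))" for k
  proof -
    have k: "k x y = (\<Sum>z\<in>Z\<times>Z. k (fst z) (snd z) * \<delta> z x y)" if "x \<in> Z" "y \<in> Z" for x y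
    proof -
      have "(\<Sum>z\<in>Z\<times>Z. k (fst z) (snd z) * \<delta> z x y) = (\<Sum>z\<in>Z\<times>Z. if z = (x, y) then k x y else 0)"
        by (intro sum.cong) (auto simp: \<delta>_def)
      then show ?thesis using that Z by simp
    qed
    have "chain k a l b = chain (\<lambda>x y. \<Sum>z\<in>Z\<times>Z. k (fst z) (snd z) * \<delta> z x y) a l b"
      using k ab lZ by (intro chain_cong[where Z=Z]) auto
    also have "\<dots> = (\<Sum>z\<in>Z\<times>Z. k (fst z) (snd z) * chain (\<delta> z) a l b)"
      using Z by (simp add: chain_sum chain_mult)
    finally show ?thesis
      using k[OF ab] by (simp add: sum_subtractf algebra_simps)
  qed
  \<comment> \<open>move a small mass once around the cycle; marginals are preserved because the sum telescopes\<close>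
  define v where "v = (\<lambda>z. w z + e * ?L (\<delta> z))"
  have v0: "0 \<le> v z" for z
  proof (cases "z \<in> S")
    case True
    have "- real (length l) \<le> chain (\<delta> z) a l b" by (rule chain_lower) (auto simp: \<delta>_def)
    moreover have "\<delta> z a b \<le> 1" by (simp add: \<delta>_def)
    ultimately have "- (1 + real (length l)) \<le> ?L (\<delta> z)" by linarith
    then have "e * - (1 + real (length l)) \<le> e * ?L (\<delta> z)"
      using e0 by (intro mult_left_mono) auto
    moreover have "e * (1 + real (length l)) = Min (w ` S)" by (simp add: e_def)
    then have "e * - (1 + real (length l)) = - Min (w ` S)" by (simp only: mult_minus_right)
    moreover have "Min (w ` S) \<le> w z" using True by (intro Min_le) (auto simp: S_def)
    ultimately show ?thesis unfolding v_def by linarith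
  next
    case False
    have "0 \<le> chain (\<delta> z) a l b"
      using False by (intro chain_nonneg) (auto simp: \<delta>_def S_def)
    moreover have "\<delta> z a b = 0" using False by (auto simp: \<delta>_def S_def)
    moreover have "0 \<le> w z" by (rule transport_plansD(1)[OF w])
    ultimately show ?thesis using e0 by (simp add: v_def)
  qed
  have row: "(\<Sum>y\<in>Z. v (x, y)) = p x" if "x \<in> Z" for x
  proof -
    \<comment> \<open>The cost here is the indicator of row \<open>x\<close>: telescoping makes
      \<open>?L\<close> vanish, while its expansion is the total change in that row. Columns are
      treated alike.\<close>
    have "0 = ?L (\<lambda>s t. if s = x then 1 else 0)" by (simp add: chain_fst)
    also have "\<dots> = (\<Sum>z\<in>Z\<times>Z. if fst z = x then ?L (\<delta> z) else 0)"
      by (rule trans[OF lin]) (auto intro!: sum.cong)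
    also have "\<dots> = (\<Sum>s\<in>Z. \<Sum>t\<in>Z. if s = x then ?L (\<delta> (s, t)) else 0)"
      unfolding sum.cartesian_product by (intro sum.cong) auto
    also have "\<dots> = (\<Sum>t\<in>Z. ?L (\<delta> (x, t)))"
      using Z that by (subst sum.swap) simp
    finally show ?thesis
      using transport_plansD(3)[OF w that] by (simp add: v_def sum.distrib flip: sum_distrib_left)
  qed
  have col: "(\<Sum>y\<in>Z. v (y, x)) = q x" if "x \<in> Z" for x
  proof -
    have "0 = ?L (\<lambda>s t. if t = x then 1 else 0)" by (simp add: chain_snd)
    also have "\<dots> = (\<Sum>z\<in>Z\<times>Z. if snd z = x then ?L (\<delta> z) else 0)"
      by (rule trans[OF lin]) (auto intro!: sum.cong)
    also have "\<dots> = (\<Sum>s\<in>Z. \<Sum>t\<in>Z. if t = x then ?L (\<delta> (s, t)) else 0)"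
      unfolding sum.cartesian_product by (intro sum.cong) auto
    also have "\<dots> = (\<Sum>s\<in>Z. ?L (\<delta> (s, x)))"
      using Z that by simp
    finally show ?thesis
      using transport_plansD(4)[OF w that] by (simp add: v_def sum.distrib flip: sum_distrib_left)
  qed
  have off: "v z = 0" if "z \<notin> Z \<times> Z" for z
  proof -
    have "chain (\<delta> z) a l b = chain (\<lambda>x y. 0) a l b"
      using that ab lZ by (intro chain_cong[where Z=Z]) (auto simp: \<delta>_def)
    also have "\<dots> = 0" by (rule chain_fst)
    finally have "?L (\<delta> z) = 0" using that ab by (auto simp: \<delta>_def)
    then show ?thesis using transport_plansD(2)[OF w that] by (simp add: v_def)
  qed
  have "v \<in> transport_plans Z p q"
    using v0 row col off unfolding transport_plans_def by blast
  from opt[OF this] have "0 \<le> (\<Sum>z\<in>Z\<times>Z. (e * ?L (\<delta> z)) * h (fst z) (snd z))"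
    unfolding v_def by (simp add: distrib_right sum.distrib)
  also have "\<dots> = e * ?L h"
    unfolding lin[of h] by (simp add: sum_distrib_left mult_ac)
  finally show ?thesis using e0 by (simp add: zero_le_mult_iff)
qed

text \<open>The start point occurs in the first term alone, so one triangle inequality suffices. The
  bound then passes to an infimum over chains.\<close>

lemma chain_dist_lipschitz: "chain dist x l e \<le> dist x y + chain dist y l e"
proof (cases l)
  case Nil
  then show ?thesis by (simp add: dist_triangle)
next
  case (Cons p l')
  then show ?thesis using dist_triangle by (cases p) auto
qed

lemma chain_dist_end: "chain dist x l e \<le> chain dist x l e' + dist e' e"
  by (induction l arbitrary: x) (auto simp: dist_triangle)

text \<open>Complementary slackness: \<open>u\<close> is 1-Lipschitz and falls by at least
  \<open>dist a b\<close> along every pair charged by \<open>w\<close>, so its dual value reaches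
  the cost of \<open>w\<close>. It is Rockafellar's potential for a metric cost. As chains may start
  anywhere, it is defined on the whole space and requires no Lipschitz extension from
  \<open>Z\<close>.\<close>

theorem finite_Kantorovich_duality:
  fixes Z :: "'a::metric_space set"
  assumes Z: "finite Z" and p: "\<And>a. 0 \<le> p a" "sum p Z = 1" and q: "\<And>a. 0 \<le> q a" "sum q Z = 1"
  obtains w u where "w \<in> transport_plans Z p q" "1-lipschitz_on UNIV u"
    "(\<Sum>z\<in>Z\<times>Z. w z * dist (fst z) (snd z)) \<le> (\<Sum>z\<in>Z. u z * p z) - (\<Sum>z\<in>Z. u z * q z :: real)"
proof -
  have "continuous_on (transport_plans Z p q) (\<lambda>w. \<Sum>z\<in>Z\<times>Z. w z * dist (fst z) (snd z))"
    by (intro continuous_intros continuous_on_subset[OF continuous_on_product_coordinates]) auto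
  then obtain w where w: "w \<in> transport_plans Z p q"
    and opt: "\<And>v. v \<in> transport_plans Z p q \<Longrightarrow>
      (\<Sum>z\<in>Z\<times>Z. w z * dist (fst z) (snd z)) \<le> (\<Sum>z\<in>Z\<times>Z. v z * dist (fst z) (snd z))"
    using continuous_attains_inf[OF compact_transport_plans[OF Z p(1)] transport_plans_nonempty[OF Z p(1) q(1) p(2) q(2)]]
    by blast
  define S where "S = {z. 0 < w z}"
  \<comment> \<open>An arbitrary base point at which all chains end; it may lie outside
    \<open>Z\<close>.\<close>
  define o' where "o' = (undefined :: 'a)"
  define u where "u = (\<lambda>x. INF l\<in>lists S. chain dist x l o')"
  \<comment> \<open>Cyclical monotonicity enters here: closing the chain at \<open>b\<close> instead
    of \<open>o'\<close> costs at most \<open>dist o' b\<close>, so chains cannot become arbitrarily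
    negative and the infimum is finite.\<close>
  have lower: "- dist x o' \<le> chain dist x l o'" if "l \<in> lists S" for x l
  proof (cases l)
    case Nil
    moreover have "- dist x o' \<le> dist x o'" by (rule order_trans[of _ 0]) auto
    ultimately show ?thesis by simp
  next
    case (Cons z l')
    obtain a b where z: "z = (a, b)" by fastforce
    have "dist a b \<le> chain dist a l' b"
      using that Cons z by (intro optimal_plan_cyclically_monotone[OF Z w opt]) (auto simp: S_def)
    moreover have "chain dist a l' b \<le> chain dist a l' o' + dist o' b" by (rule chain_dist_end)
    moreover have "dist o' b \<le> dist x o' + dist x b" by (metis dist_commute dist_triangle)
    ultimately show ?thesis using Cons z by simp
  qed
  have bdd: "bdd_below ((\<lambda>l. chain dist x l o') ` lists S)" for x
    using lower by (intro bdd_belowI2)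
  have u_le: "u x \<le> chain dist x l o'" if "l \<in> lists S" for x l
    unfolding u_def using bdd that by (rule cINF_lower)
  have u_ge: "c \<le> u x" if "\<And>l. l \<in> lists S \<Longrightarrow> c \<le> chain dist x l o'" for c x
    unfolding u_def using that by (intro cINF_greatest) auto
  have lip: "u x \<le> dist x y + u y" for x y
  proof -
    have "u x - dist x y \<le> u y"
    proof (rule u_ge)
      fix l assume "l \<in> lists S"
      from u_le[OF this, of x] chain_dist_lipschitz[of x l o' y]
      show "u x - dist x y \<le> chain dist y l o'" by simp
    qed
    then show ?thesis by simp
  qed
  have lipschitz: "1-lipschitz_on UNIV u"
  proof (rule lipschitz_onI)
    fix x y show "dist (u x) (u y) \<le> 1 * dist x y"
      using lip[of x y] lip[of y x] by (auto simp: dist_real_def dist_commute)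
  qed simp
  \<comment> \<open>Prepending \<open>(a, b)\<close> turns a chain from \<open>a\<close> into a
    chain from \<open>b\<close>; its new leading term is \<open>dist b b = 0\<close>, so the value
    drops by exactly \<open>dist a b\<close>.\<close>
  have tight: "dist a b \<le> u a - u b" if "(a, b) \<in> S" for a b
  proof -
    have "u b + dist a b \<le> u a"
    proof (rule u_ge)
      fix l assume "l \<in> lists S"
      then have "u b \<le> chain dist b ((a, b) # l) o'" using that by (intro u_le) auto
      then show "u b + dist a b \<le> chain dist a l o'" by simp
    qed
    then show ?thesis by simp
  qed
  have "(\<Sum>z\<in>Z\<times>Z. w z * dist (fst z) (snd z)) \<le> (\<Sum>z\<in>Z\<times>Z. w z * (u (fst z) - u (snd z)))"
  proof (intro sum_mono)
    fix z
    show "w z * dist (fst z) (snd z) \<le> w z * (u (fst z) - u (snd z))"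
    proof (cases "z \<in> S")
      case True
      then show ?thesis using tight[of "fst z" "snd z"] by (intro mult_left_mono) (auto simp: S_def)
    next
      case False
      moreover have "0 \<le> w z" by (rule transport_plansD(1)[OF w])
    ultimately have "w z = 0" by (simp add: S_def)
      then show ?thesis by simp
    qed
  qed
  also have "\<dots> = (\<Sum>z\<in>Z\<times>Z. w z * u (fst z)) - (\<Sum>z\<in>Z\<times>Z. w z * u (snd z))"
    by (simp add: sum_subtractf right_diff_distrib)
  also have "(\<Sum>z\<in>Z\<times>Z. w z * u (fst z)) = (\<Sum>a\<in>Z. \<Sum>b\<in>Z. u a * w (a, b))"
    by (simp add: sum.cartesian_product split_def mult.commute)
  also have "\<dots> = (\<Sum>z\<in>Z. u z * p z)"
    by (simp add: transport_plansD[OF w] flip: sum_distrib_left)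
  also have "(\<Sum>z\<in>Z\<times>Z. w z * u (snd z)) = (\<Sum>a\<in>Z. \<Sum>b\<in>Z. u b * w (a, b))"
    by (simp add: sum.cartesian_product split_def mult.commute)
  also have "\<dots> = (\<Sum>z\<in>Z. u z * q z)"
    by (subst sum.swap) (simp add: transport_plansD[OF w] flip: sum_distrib_left)
  finally show ?thesis by (rule that[OF w lipschitz])
qed

section \<open>Kantorovich-Rubinstein duality\<close>

lemma nn_integral_simple_comp:
  assumes "simple_function M T"
  shows "(\<integral>\<^sup>+x. g (T x) \<partial>M) = (\<Sum>z\<in>T ` space M. g z * emeasure M (T -` {z} \<inter> space M))"
proof -
  have "simple_function M (\<lambda>x. g (T x))" by (rule simple_function_compose1[OF assms])
  have fin: "finite (T ` space M)" using assms by (rule simple_functionD)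
  have m[measurable]: "T -` {z} \<inter> space M \<in> sets M" for z using assms by (rule simple_functionD)
  have "(\<integral>\<^sup>+x. g (T x) \<partial>M) = (\<integral>\<^sup>+x. (\<Sum>z\<in>T ` space M. g z * indicator (T -` {z} \<inter> space M) x) \<partial>M)"
  proof (intro nn_integral_cong)
    fix x assume x: "x \<in> space M"
    have "(\<Sum>z\<in>T ` space M. g z * indicator (T -` {z} \<inter> space M) x) = (\<Sum>z\<in>T ` space M. if z = T x then g z else 0)"
      using x by (intro sum.cong) auto
    then show "g (T x) = (\<Sum>z\<in>T ` space M. g z * indicator (T -` {z} \<inter> space M) x)"
      using x fin by simp
  qed
  then show ?thesis by (simp add: nn_integral_sum nn_integral_cmult_indicator)
qed

lemma integral_simple_comp:
  fixes g :: "'b \<Rightarrow> real"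
  assumes "finite_measure M" "simple_function M T"
  shows "(\<integral>x. g (T x) \<partial>M) = (\<Sum>z\<in>T ` space M. g z * measure M (T -` {z} \<inter> space M))"
proof -
  interpret finite_measure M by fact
  have fin: "finite (T ` space M)" using assms(2) by (rule simple_functionD)
  have m[measurable]: "T -` {z} \<inter> space M \<in> sets M" for z using assms(2) by (rule simple_functionD)
  have "(\<integral>x. g (T x) \<partial>M) = (\<integral>x. (\<Sum>z\<in>T ` space M. g z * indicator (T -` {z} \<inter> space M) x) \<partial>M)"
  proof (intro Bochner_Integration.integral_cong refl)
    fix x assume x: "x \<in> space M"
    have "(\<Sum>z\<in>T ` space M. g z * indicator (T -` {z} \<inter> space M) x) = (\<Sum>z\<in>T ` space M. if z = T x then g z else 0)"
      using x by (intro sum.cong) auto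
    then show "g (T x) = (\<Sum>z\<in>T ` space M. g z * indicator (T -` {z} \<inter> space M) x)"
      using x fin by simp
  qed
  also have "\<dots> = (\<Sum>z\<in>T ` space M. (\<integral>x. g z * indicator (T -` {z} \<inter> space M) x \<partial>M))"
    by (rule Bochner_Integration.integral_sum)
      (auto intro!: integrable_mult_right integrable_real_indicator simp: emeasure_eq_measure)
  finally show ?thesis by simp
qed

text \<open>The identity is a pointwise limit of simple maps whose distance to \<open>x0\<close> at
  most doubles, so dominated convergence applies. One map serves both measures, which puts the two
  discrete marginals on the same finite set.\<close>

lemma simple_approx_in_mean:
  fixes \<mu> \<nu> :: "'a::polish_space measure"
  assumes s: "sets \<mu> = sets borel" "sets \<nu> = sets borel"
    and i: "integrable \<mu> (dist x0)" "integrable \<nu> (dist x0)" and e: "0 < e"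
  obtains T where "simple_function borel T"
    "integrable \<mu> (\<lambda>x. dist (T x) x)" "(\<integral>x. dist (T x) x \<partial>\<mu>) < e"
    "integrable \<nu> (\<lambda>x. dist (T x) x)" "(\<integral>x. dist (T x) x \<partial>\<nu>) < e"
proof -
  have "\<exists>F. (\<forall>i. simple_function borel (F i)) \<and> (\<forall>x\<in>space borel. (\<lambda>i. F i x) \<longlonglongrightarrow> x) \<and>
    (\<forall>i. \<forall>x\<in>space borel. dist (F i x) x0 \<le> 2 * dist (x::'a) x0)"
    by (rule borel_measurable_implies_sequence_metric) simp
  then obtain F where F: "\<And>i. simple_function borel (F i)" "\<And>x::'a. (\<lambda>i. F i x) \<longlonglongrightarrow> x"
    "\<And>i x. dist (F i x) x0 \<le> 2 * dist x x0" by auto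
  have [measurable]: "F i \<in> borel_measurable borel" for i
    using F(1) by (rule borel_measurable_simple_function)
  have bound: "dist (F i x) x \<le> 3 * dist x0 x" for i x
    using F(3)[of i x] dist_triangle[of "F i x" x x0] by (simp add: dist_commute)
  have int: "integrable M (\<lambda>x. dist (F i x) x)"
    and lim: "(\<lambda>i. \<integral>x. dist (F i x) x \<partial>M) \<longlonglongrightarrow> 0"
    if [measurable_cong]: "sets M = sets borel" and M: "integrable M (dist x0)" for M i
  proof -
    show "integrable M (\<lambda>x. dist (F i x) x)"
      by (rule Bochner_Integration.integrable_bound[OF integrable_mult_right[OF M, of 3]]) (use bound in auto)
    have "(\<lambda>i. \<integral>x. dist (F i x) x \<partial>M) \<longlonglongrightarrow> (\<integral>x. 0 \<partial>M)"
    proof (rule integral_dominated_convergence[OF _ _ integrable_mult_right[OF M, of 3]])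
      show "AE x in M. (\<lambda>i. dist (F i x) x) \<longlonglongrightarrow> 0"
        using F(2) by (intro AE_I2) (simp add: tendsto_dist_iff[symmetric])
    qed (use bound in auto)
    then show "(\<lambda>i. \<integral>x. dist (F i x) x \<partial>M) \<longlonglongrightarrow> 0" by simp
  qed
  have "\<forall>\<^sub>F i in sequentially. (\<integral>x. dist (F i x) x \<partial>\<mu>) < e \<and> (\<integral>x. dist (F i x) x \<partial>\<nu>) < e"
    using order_tendstoD(2)[OF lim[OF s(1) i(1)] e] order_tendstoD(2)[OF lim[OF s(2) i(2)] e]
    by (rule eventually_conj)
  then obtain i where "(\<integral>x. dist (F i x) x \<partial>\<mu>) < e" "(\<integral>x. dist (F i x) x \<partial>\<nu>) < e"
    by (auto simp: eventually_sequentially)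
  then show ?thesis using that[of "F i"] F(1) int s i by blast
qed

lemma simple_function_comp2:
  assumes "f \<in> measurable M N" "simple_function N T"
  shows "simple_function M (\<lambda>x. T (f x))"
  unfolding simple_function_def
proof (intro conjI ballI)
  have "(\<lambda>x. T (f x)) ` space M \<subseteq> T ` space N" using measurable_space[OF assms(1)] by auto
  then show "finite ((\<lambda>x. T (f x)) ` space M)"
    using simple_functionD(1)[OF assms(2)] by (rule finite_subset)
  fix z
  have "(\<lambda>x. T (f x)) -` {z} \<inter> space M = f -` (T -` {z} \<inter> space N) \<inter> space M"
    using measurable_space[OF assms(1)] by auto
  also have "\<dots> \<in> sets M" using simple_functionD(2)[OF assms(2)] by (rule measurable_sets[OF assms(1)])
  finally show "(\<lambda>x. T (f x)) -` {z} \<inter> space M \<in> sets M" .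
qed

text \<open>On each product of cells of \<open>T\<close> the mass \<open>w (a, b)\<close> is spread
  as a multiple of the product measure. A cost that depends on the cells alone is then the cost of
  the finite plan.\<close>

lemma coupling_of_finite_plan:
  fixes \<mu> \<nu> :: "'a::polish_space measure" and T :: "'a \<Rightarrow> 'a"
  assumes "prob_space \<mu>" "prob_space \<nu>" and s[measurable_cong]: "sets \<mu> = sets borel" "sets \<nu> = sets borel"
    and T: "simple_function borel T"
    and w: "w \<in> transport_plans (range T) (\<lambda>z. measure \<mu> (T -` {z})) (\<lambda>z. measure \<nu> (T -` {z}))"
  obtains \<gamma> where "\<gamma> \<in> couplings \<mu> \<nu>"
    "(\<integral>\<^sup>+r. ennreal (c (T (fst r)) (T (snd r))) \<partial>\<gamma>) = (\<Sum>z\<in>range T \<times> range T. ennreal (c (fst z) (snd z)) * ennreal (w z))"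
proof -
  interpret \<mu>: prob_space \<mu> by fact
  interpret \<nu>: prob_space \<nu> by fact
  interpret P: pair_sigma_finite \<mu> \<nu> ..
  define p where "p = (\<lambda>z. measure \<mu> (T -` {z}))"
  define q where "q = (\<lambda>z. measure \<nu> (T -` {z}))"
  define Z where "Z = range T"
  have fin: "finite Z" using simple_functionD(1)[OF T] by (simp add: Z_def)
  have [simp]: "space \<mu> = UNIV" "space \<nu> = UNIV" using s[THEN sets_eq_imp_space_eq] by auto
  have T': "simple_function \<mu> T" "simple_function \<nu> T"
    using T s by (simp_all add: simple_function_def)
  have [measurable]: "T \<in> borel_measurable borel" using T by (rule borel_measurable_simple_function)
  have Tc[measurable]: "T \<in> measurable borel (count_space UNIV)" using T by (rule measurable_simple_function)
  note wD = transport_plansD[OF w[folded p_def q_def Z_def]]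
  have p0: "0 \<le> p z" and q0: "0 \<le> q z" for z by (simp_all add: p_def q_def)
  have wp: "w (a, b) = 0" if "a \<in> Z" "b \<in> Z" "p a = 0" for a b
  proof -
    have "w (a, b) \<le> (\<Sum>b\<in>Z. w (a, b))" using fin that wD(1) by (intro member_le_sum) auto
    then show ?thesis using wD(1)[of "(a, b)"] wD(3)[OF that(1)] that by simp
  qed
  have wq: "w (a, b) = 0" if "a \<in> Z" "b \<in> Z" "q b = 0" for a b
  proof -
    have "w (a, b) \<le> (\<Sum>a\<in>Z. w (a, b))" using fin that wD(1) by (intro member_le_sum) auto
    then show ?thesis using wD(1)[of "(a, b)"] wD(4)[OF that(2)] that by simp
  qed
  \<comment> \<open>Division by zero yields 0 here. This loses nothing, since by \<open>wp\<close>
    and \<open>wq\<close> a plan puts no mass on a cell of measure zero.\<close>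
  define W where "W = (\<lambda>a b. w (a, b) / (p a * q b))"
  have W0: "0 \<le> W a b" for a b using wD(1) p0 q0 by (simp add: W_def)
  have int\<mu>: "(\<integral>\<^sup>+x. g (T x) \<partial>\<mu>) = (\<Sum>z\<in>Z. g z * ennreal (p z))"
    and int\<nu>: "(\<integral>\<^sup>+x. g (T x) \<partial>\<nu>) = (\<Sum>z\<in>Z. g z * ennreal (q z))" for g
    using nn_integral_simple_comp[OF T'(1), of g] nn_integral_simple_comp[OF T'(2), of g]
    by (simp_all add: Z_def p_def q_def \<mu>.emeasure_eq_measure \<nu>.emeasure_eq_measure)
  have row: "(\<integral>\<^sup>+y. ennreal (W a (T y)) \<partial>\<nu>) = 1" if "a \<in> Z" "p a \<noteq> 0" for a
  proof -
    have "(\<integral>\<^sup>+y. ennreal (W a (T y)) \<partial>\<nu>) = (\<Sum>b\<in>Z. ennreal (W a b * q b))"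
      using W0 q0 by (simp add: int\<nu>[of "\<lambda>b. ennreal (W a b)"] ennreal_mult)
    also have "\<dots> = (\<Sum>b\<in>Z. ennreal (w (a, b) / p a))"
      using wq[OF that(1)] by (intro sum.cong refl) (auto simp: W_def)
    also have "\<dots> = ennreal ((\<Sum>b\<in>Z. w (a, b)) / p a)"
      using wD(1) p0 by (simp add: sum_divide_distrib)
    finally show ?thesis using wD(3)[OF that(1)] that by simp
  qed
  have col: "(\<integral>\<^sup>+x. ennreal (W (T x) b) \<partial>\<mu>) = 1" if "b \<in> Z" "q b \<noteq> 0" for b
  proof -
    have "(\<integral>\<^sup>+x. ennreal (W (T x) b) \<partial>\<mu>) = (\<Sum>a\<in>Z. ennreal (W a b * p a))"
      using W0 p0 by (simp add: int\<mu>[of "\<lambda>a. ennreal (W a b)"] ennreal_mult)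
    also have "\<dots> = (\<Sum>a\<in>Z. ennreal (w (a, b) / q b))"
      using wp[OF _ that(1)] by (intro sum.cong refl) (auto simp: W_def)
    also have "\<dots> = ennreal ((\<Sum>a\<in>Z. w (a, b)) / q b)"
      using wD(1) q0 by (simp add: sum_divide_distrib)
    finally show ?thesis using wD(4)[OF that(1)] that by simp
  qed
  \<comment> \<open>\<open>row\<close> fails on cells of measure zero. There are finitely many of
    them, so their union is null and the marginal can be checked almost everywhere.\<close>
  have AE\<mu>: "AE x in \<mu>. p (T x) \<noteq> 0"
  proof -
    have "AE x in \<mu>. \<forall>z\<in>Z. p z = 0 \<longrightarrow> x \<notin> T -` {z}"
    proof (rule AE_finite_allI[OF fin])
      fix z
      have "T -` {z} \<in> sets \<mu>" using simple_functionD(2)[OF T, of "{z}"] s by simp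
      then have "T -` {z} \<in> null_sets \<mu>" if "p z = 0"
        using that by (simp add: p_def \<mu>.emeasure_eq_measure null_sets_def)
      then have "AE x in \<mu>. x \<notin> T -` {z}" if "p z = 0"
        using that by (intro AE_not_in)
      then show "AE x in \<mu>. p z = 0 \<longrightarrow> x \<notin> T -` {z}"
        by (cases "p z = 0") auto
    qed
    then show ?thesis by eventually_elim (auto simp: Z_def)
  qed
  have AE\<nu>: "AE x in \<nu>. q (T x) \<noteq> 0"
  proof -
    have "AE x in \<nu>. \<forall>z\<in>Z. q z = 0 \<longrightarrow> x \<notin> T -` {z}"
    proof (rule AE_finite_allI[OF fin])
      fix z
      have "T -` {z} \<in> sets \<nu>" using simple_functionD(2)[OF T, of "{z}"] s by simp
      then have "T -` {z} \<in> null_sets \<nu>" if "q z = 0"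
        using that by (simp add: q_def \<nu>.emeasure_eq_measure null_sets_def)
      then have "AE x in \<nu>. x \<notin> T -` {z}" if "q z = 0"
        using that by (intro AE_not_in)
      then show "AE x in \<nu>. q z = 0 \<longrightarrow> x \<notin> T -` {z}"
        by (cases "q z = 0") auto
    qed
    then show ?thesis by eventually_elim (auto simp: Z_def)
  qed
  \<comment> \<open>\<open>k\<close> is arbitrary; factoring through the finite-valued pair of cells
    is what gives measurability.\<close>
  have comp[measurable]: "(\<lambda>r. k (T (fst r)) (T (snd r))) \<in> borel_measurable (borel \<Otimes>\<^sub>M borel)" for k :: "'a \<Rightarrow> 'a \<Rightarrow> real"
  proof -
    have "simple_function (borel \<Otimes>\<^sub>M borel) (\<lambda>r::'a\<times>'a. T (fst r))"
      "simple_function (borel \<Otimes>\<^sub>M borel) (\<lambda>r::'a\<times>'a. T (snd r))"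
      by (auto intro!: simple_function_comp2[OF _ T])
    then have "simple_function (borel \<Otimes>\<^sub>M borel) (\<lambda>r::'a\<times>'a. (T (fst r), T (snd r)))"
      by (rule simple_function_Pair)
    then have "simple_function (borel \<Otimes>\<^sub>M borel) (\<lambda>r::'a\<times>'a. case_prod k (T (fst r), T (snd r)))"
      by (rule simple_function_compose1)
    then show ?thesis by (auto intro: borel_measurable_simple_function)
  qed
  define \<gamma> where "\<gamma> = density (\<mu> \<Otimes>\<^sub>M \<nu>) (\<lambda>r. ennreal (W (T (fst r)) (T (snd r))))"
  have sets\<gamma>: "sets \<gamma> = sets (borel \<Otimes>\<^sub>M borel)"
    unfolding \<gamma>_def sets_density by (intro sets_pair_measure_cong s)
  have m1[measurable]: "(\<lambda>x. k (T x)) \<in> borel_measurable borel" for k :: "'a \<Rightarrow> ennreal"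
    using simple_function_compose1[OF T, of k] by (rule borel_measurable_simple_function)
  have nn\<gamma>: "(\<integral>\<^sup>+r. h r \<partial>\<gamma>) = (\<integral>\<^sup>+r. ennreal (W (T (fst r)) (T (snd r))) * h r \<partial>(\<mu> \<Otimes>\<^sub>M \<nu>))"
    if "h \<in> borel_measurable (borel \<Otimes>\<^sub>M borel)" for h
    unfolding \<gamma>_def using that by (intro nn_integral_density) measurable
  have fst_marg: "distr \<gamma> borel fst = \<mu>"
  proof (rule measure_eqI)
    fix A assume "A \<in> sets (distr \<gamma> borel fst)"
    then have A[measurable]: "A \<in> sets borel" by simp
    have "emeasure (distr \<gamma> borel fst) A = (\<integral>\<^sup>+x. indicator A x \<partial>distr \<gamma> borel fst)" by simp
    also have "\<dots> = (\<integral>\<^sup>+r. indicator A (fst r) \<partial>\<gamma>)"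
      by (rule nn_integral_distr) (simp_all add: measurable_cong_sets[OF sets\<gamma> refl])
    also have "\<dots> = (\<integral>\<^sup>+r. ennreal (W (T (fst r)) (T (snd r))) * indicator A (fst r) \<partial>(\<mu> \<Otimes>\<^sub>M \<nu>))"
      by (rule nn\<gamma>) measurable
    also have "\<dots> = (\<integral>\<^sup>+x. (\<integral>\<^sup>+y. ennreal (W (T x) (T y)) * indicator A x \<partial>\<nu>) \<partial>\<mu>)"
      by (subst \<nu>.nn_integral_fst[symmetric]) auto
    also have "\<dots> = (\<integral>\<^sup>+x. indicator A x \<partial>\<mu>)"
      using AE\<mu>
    proof (intro nn_integral_cong_AE, eventually_elim)
      case (elim x)
      then show ?case by (simp add: nn_integral_multc row Z_def)
    qed
    finally show "emeasure (distr \<gamma> borel fst) A = emeasure \<mu> A" using A by (simp add: s)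
  qed (simp add: s)
  have snd_marg: "distr \<gamma> borel snd = \<nu>"
  proof (rule measure_eqI)
    fix A assume "A \<in> sets (distr \<gamma> borel snd)"
    then have A[measurable]: "A \<in> sets borel" by simp
    have "emeasure (distr \<gamma> borel snd) A = (\<integral>\<^sup>+x. indicator A x \<partial>distr \<gamma> borel snd)" by simp
    also have "\<dots> = (\<integral>\<^sup>+r. indicator A (snd r) \<partial>\<gamma>)"
      by (rule nn_integral_distr) (simp_all add: measurable_cong_sets[OF sets\<gamma> refl])
    also have "\<dots> = (\<integral>\<^sup>+r. ennreal (W (T (fst r)) (T (snd r))) * indicator A (snd r) \<partial>(\<mu> \<Otimes>\<^sub>M \<nu>))"
      by (rule nn\<gamma>) measurable
    also have "\<dots> = (\<integral>\<^sup>+y. (\<integral>\<^sup>+x. ennreal (W (T x) (T y)) * indicator A y \<partial>\<mu>) \<partial>\<nu>)"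
      by (subst P.nn_integral_snd[symmetric]) (auto simp: split_def)
    also have "\<dots> = (\<integral>\<^sup>+x. indicator A x \<partial>\<nu>)"
      using AE\<nu>
    proof (intro nn_integral_cong_AE, eventually_elim)
      case (elim x)
      then show ?case by (simp add: nn_integral_multc col Z_def)
    qed
    finally show "emeasure (distr \<gamma> borel snd) A = emeasure \<nu> A" using A by (simp add: s)
  qed (simp add: s)
  have "(\<integral>\<^sup>+r. ennreal (c (T (fst r)) (T (snd r))) \<partial>\<gamma>)
      = (\<integral>\<^sup>+r. ennreal (W (T (fst r)) (T (snd r))) * ennreal (c (T (fst r)) (T (snd r))) \<partial>(\<mu> \<Otimes>\<^sub>M \<nu>))"
    by (rule nn\<gamma>) measurable
  also have "\<dots> = (\<integral>\<^sup>+x. (\<integral>\<^sup>+y. ennreal (W (T x) (T y)) * ennreal (c (T x) (T y)) \<partial>\<nu>) \<partial>\<mu>)"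
    by (subst \<nu>.nn_integral_fst[symmetric]) auto
  also have "\<dots> = (\<Sum>a\<in>Z. (\<Sum>b\<in>Z. ennreal (W a b) * ennreal (c a b) * ennreal (q b)) * ennreal (p a))"
    by (simp add: int\<nu>[of "\<lambda>b. ennreal (W a b) * ennreal (c a b)" for a]
      int\<mu>[of "\<lambda>a. \<Sum>b\<in>Z. ennreal (W a b) * ennreal (c a b) * ennreal (q b)"])
  also have "\<dots> = (\<Sum>a\<in>Z. \<Sum>b\<in>Z. ennreal (c a b) * ennreal (w (a, b)))"
    unfolding sum_distrib_right
  proof (intro sum.cong refl)
    fix a b assume ab: "a \<in> Z" "b \<in> Z"
    have "W a b * q b * p a = w (a, b)" using wp[OF ab] wq[OF ab] by (auto simp: W_def)
    then have "ennreal (W a b) * ennreal (q b) * ennreal (p a) = ennreal (w (a, b))"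
      using W0 p0 q0 by (simp flip: ennreal_mult)
    then show "ennreal (W a b) * ennreal (c a b) * ennreal (q b) * ennreal (p a) = ennreal (c a b) * ennreal (w (a, b))"
      by (metis mult.assoc mult.commute)
  qed
  also have "\<dots> = (\<Sum>z\<in>Z \<times> Z. ennreal (c (fst z) (snd z)) * ennreal (w z))"
    by (simp add: sum.cartesian_product split_def)
  finally show ?thesis
    using that[of \<gamma>] sets\<gamma> fst_marg snd_marg by (simp add: couplings_def Z_def)
qed

section \<open>Lipschitz test functions and the two halves of the duality\<close>

lemma lipschitz_borel_measurable:
  fixes \<phi> :: "'a::metric_space \<Rightarrow> real"
  assumes "L-lipschitz_on UNIV \<phi>"
  shows "\<phi> \<in> borel_measurable borel"
  using lipschitz_on_continuous_on[OF assms] by (rule borel_measurable_continuous_onI)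

lemma lipschitz_abs_diff_le:
  fixes \<phi> :: "'a::metric_space \<Rightarrow> real"
  assumes "L-lipschitz_on UNIV \<phi>"
  shows "\<bar>\<phi> x - \<phi> y\<bar> \<le> L * dist x y"
  using lipschitz_onD[OF assms, of x y] by (simp add: dist_real_def)

lemma dist_lipschitz: "1-lipschitz_on UNIV (dist (x0 :: 'a::metric_space))"
proof (rule lipschitz_onI)
  fix x y show "dist (dist x0 x) (dist x0 y) \<le> 1 * dist x y"
    using dist_triangle[of x0 x y] dist_triangle[of x0 y x] by (simp add: dist_real_def abs_le_iff dist_commute)
qed simp

lemma integrable_lipschitz:
  fixes \<phi> :: "'a::metric_space \<Rightarrow> real"
  assumes "finite_measure \<mu>" and s[measurable_cong]: "sets \<mu> = sets borel"
    and i: "integrable \<mu> (dist x0)" and L: "L-lipschitz_on UNIV \<phi>"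
  shows "integrable \<mu> \<phi>"
proof -
  interpret finite_measure \<mu> by fact
  note [measurable] = lipschitz_borel_measurable[OF L]
  show ?thesis
  proof (rule Bochner_Integration.integrable_bound)
    show "integrable \<mu> (\<lambda>x. \<bar>\<phi> x0\<bar> + L * dist x0 x)" using i by simp
    show "AE x in \<mu>. norm (\<phi> x) \<le> norm (\<bar>\<phi> x0\<bar> + L * dist x0 x)"
      using lipschitz_abs_diff_le[OF L, of x0] by (intro AE_I2) (smt (verit) real_norm_def)
  qed measurable
qed

text \<open>This is the hard half of the duality. The transport problem between the images under
  \<open>T\<close> has an exact dual potential; the errors are the mean displacements of
  \<open>T\<close>. Testing on bounded functions is enough because the potential matters only on the
  finite range of \<open>T\<close> and can be clipped.\<close>

theorem W1_le_of_lipschitz_bound: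
  fixes \<mu> \<nu> :: "'a::polish_space measure"
  assumes prob: "prob_space \<mu>" "prob_space \<nu>" and s[measurable_cong]: "sets \<mu> = sets borel" "sets \<nu> = sets borel"
    and i: "integrable \<mu> (dist x0)" "integrable \<nu> (dist x0)"
    and D: "\<And>\<phi> B. 1-lipschitz_on UNIV \<phi> \<Longrightarrow> (\<And>x. \<bar>\<phi> x\<bar> \<le> B) \<Longrightarrow> (\<integral>x. \<phi> x \<partial>\<mu>) - (\<integral>x. \<phi> x \<partial>\<nu>) \<le> D"
  shows "W1 \<mu> \<nu> \<le> ereal D"
proof (rule ereal_le_epsilon2)
  interpret \<mu>: prob_space \<mu> by fact
  interpret \<nu>: prob_space \<nu> by fact
  have [simp]: "space \<mu> = UNIV" "space \<nu> = UNIV" using s[THEN sets_eq_imp_space_eq] by auto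
  fix e :: real assume "0 < e"
  \<comment> \<open>Four errors arise: for each measure, one from replacing the test function by its
    composition with \<open>T\<close>, and one from moving the coupled points back from their
    images.\<close>
  then have e4: "0 < e / 4" by simp
  have D0: "0 \<le> D" using D[of "\<lambda>_. 0" 0] by (simp add: lipschitz_on_def)
  obtain T :: "'a \<Rightarrow> 'a" where T: "simple_function borel T"
    and T\<mu>: "integrable \<mu> (\<lambda>x. dist (T x) x)" "(\<integral>x. dist (T x) x \<partial>\<mu>) < e / 4"
    and T\<nu>: "integrable \<nu> (\<lambda>x. dist (T x) x)" "(\<integral>x. dist (T x) x \<partial>\<nu>) < e / 4"
    using simple_approx_in_mean[OF s i e4] by blast
  have [measurable]: "T \<in> borel_measurable borel" using T by (rule borel_measurable_simple_function)
  have T': "simple_function \<mu> T" "simple_function \<nu> T"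
    using T s by (simp_all add: simple_function_def)
  define Z where "Z = range T"
  have fin: "finite Z" using simple_functionD(1)[OF T] by (simp add: Z_def)
  define p where "p = (\<lambda>z. measure \<mu> (T -` {z}))"
  define q where "q = (\<lambda>z. measure \<nu> (T -` {z}))"
  have p: "(\<integral>x. g (T x) \<partial>\<mu>) = (\<Sum>z\<in>Z. g z * p z)" and q: "(\<integral>x. g (T x) \<partial>\<nu>) = (\<Sum>z\<in>Z. g z * q z)" for g
    using integral_simple_comp[OF \<mu>.finite_measure_axioms T'(1), of g]
      integral_simple_comp[OF \<nu>.finite_measure_axioms T'(2), of g] by (simp_all add: Z_def p_def q_def)
  have "sum p Z = 1" "sum q Z = 1"
    using p[of "\<lambda>_. 1"] q[of "\<lambda>_. 1"] \<mu>.prob_space \<nu>.prob_space by simp_all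
  then obtain w u where w: "w \<in> transport_plans Z p q" and u: "1-lipschitz_on UNIV u"
    and wu: "(\<Sum>z\<in>Z\<times>Z. w z * dist (fst z) (snd z)) \<le> (\<Sum>z\<in>Z. u z * p z) - (\<Sum>z\<in>Z. u z * q z)"
    using finite_Kantorovich_duality[OF fin, of p q] by (auto simp: p_def q_def)
  define R where "R = (\<Sum>z\<in>Z. \<bar>u z\<bar>)"
  \<comment> \<open>Clipping at \<open>R\<close> keeps the Lipschitz constant and changes nothing on
    \<open>Z\<close>, where \<open>u\<close> is bounded by \<open>R\<close>.\<close>
  define \<phi> where "\<phi> = (\<lambda>x. max (- R) (min R (u x)))"
  have R0: "0 \<le> R" unfolding R_def by (rule sum_nonneg) simp
  have \<phi>u: "\<phi> z = u z" if "z \<in> Z" for z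
  proof -
    have "\<bar>u z\<bar> \<le> R" unfolding R_def using fin that by (intro member_le_sum) auto
    then show ?thesis by (auto simp: \<phi>_def)
  qed
  have \<phi>: "1-lipschitz_on UNIV \<phi>"
  proof (rule lipschitz_onI)
    fix x y show "dist (\<phi> x) (\<phi> y) \<le> 1 * dist x y"
      using lipschitz_abs_diff_le[OF u, of x y] by (auto simp: \<phi>_def dist_real_def)
  qed simp
  have \<phi>R: "\<bar>\<phi> x\<bar> \<le> R" for x using R0 by (auto simp: \<phi>_def)
  note [measurable] = lipschitz_borel_measurable[OF \<phi>]
  have shift: "\<bar>(\<integral>x. \<phi> (T x) \<partial>M) - (\<integral>x. \<phi> x \<partial>M)\<bar> \<le> (\<integral>x. dist (T x) x \<partial>M)"
    if "prob_space M" and [measurable_cong]: "sets M = sets borel" and "integrable M (\<lambda>x. dist (T x) x)" for M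
  proof -
    interpret M: prob_space M by fact
    have i: "integrable M \<phi>" "integrable M (\<lambda>x. \<phi> (T x))"
      using \<phi>R by (auto intro!: M.integrable_const_bound[where B=R])
    have "\<bar>(\<integral>x. \<phi> (T x) \<partial>M) - (\<integral>x. \<phi> x \<partial>M)\<bar> = \<bar>\<integral>x. \<phi> (T x) - \<phi> x \<partial>M\<bar>"
      using i by simp
    also have "\<dots> \<le> (\<integral>x. \<bar>\<phi> (T x) - \<phi> x\<bar> \<partial>M)" by (rule integral_abs_bound)
    also have "\<dots> \<le> (\<integral>x. dist (T x) x \<partial>M)"
      using i that lipschitz_abs_diff_le[OF \<phi>] by (intro integral_mono) auto
    finally show ?thesis .
  qed
  have "(\<Sum>z\<in>Z. u z * p z) = (\<integral>x. \<phi> (T x) \<partial>\<mu>)" "(\<Sum>z\<in>Z. u z * q z) = (\<integral>x. \<phi> (T x) \<partial>\<nu>)"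
    using p[of \<phi>] q[of \<phi>] \<phi>u by simp_all
  with wu shift[OF prob(1) s(1) T\<mu>(1)] shift[OF prob(2) s(2) T\<nu>(1)] T\<mu>(2) T\<nu>(2) D[OF \<phi> \<phi>R]
  have cost: "(\<Sum>z\<in>Z\<times>Z. w z * dist (fst z) (snd z)) \<le> D + e / 2" by linarith
  obtain \<gamma> where \<gamma>: "\<gamma> \<in> couplings \<mu> \<nu>"
    and \<gamma>c: "(\<integral>\<^sup>+r. ennreal (dist (T (fst r)) (T (snd r))) \<partial>\<gamma>) = (\<Sum>z\<in>Z \<times> Z. ennreal (dist (fst z) (snd z)) * ennreal (w z))"
    using coupling_of_finite_plan[OF prob s T w[unfolded Z_def p_def q_def], of dist] unfolding Z_def by blast
  have [measurable_cong]: "sets \<gamma> = sets (borel \<Otimes>\<^sub>M borel)" and marg: "distr \<gamma> borel fst = \<mu>" "distr \<gamma> borel snd = \<nu>"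
    using \<gamma> by (auto simp: couplings_def)
  have "(\<integral>\<^sup>+r. ennreal (dist (fst r) (snd r)) \<partial>\<gamma>)
    \<le> (\<integral>\<^sup>+r. ennreal (dist (T (fst r)) (fst r)) + ennreal (dist (T (fst r)) (T (snd r))) + ennreal (dist (T (snd r)) (snd r)) \<partial>\<gamma>)"
  proof (intro nn_integral_mono)
    fix r :: "'a \<times> 'a"
    have "dist (fst r) (snd r) \<le> dist (T (fst r)) (fst r) + dist (T (fst r)) (T (snd r)) + dist (T (snd r)) (snd r)"
      using dist_triangle[of "fst r" "snd r" "T (fst r)"] dist_triangle[of "T (fst r)" "snd r" "T (snd r)"]
      by (simp add: dist_commute)
    then show "ennreal (dist (fst r) (snd r)) \<le> ennreal (dist (T (fst r)) (fst r))
        + ennreal (dist (T (fst r)) (T (snd r))) + ennreal (dist (T (snd r)) (snd r))"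
      by (simp flip: ennreal_plus)
  qed
  also have "\<dots> = (\<integral>\<^sup>+r. ennreal (dist (T (fst r)) (fst r)) \<partial>\<gamma>)
      + (\<integral>\<^sup>+r. ennreal (dist (T (fst r)) (T (snd r))) \<partial>\<gamma>) + (\<integral>\<^sup>+r. ennreal (dist (T (snd r)) (snd r)) \<partial>\<gamma>)"
    by (simp add: nn_integral_add)
  also have "(\<integral>\<^sup>+r. ennreal (dist (T (fst r)) (fst r)) \<partial>\<gamma>) = (\<integral>\<^sup>+x. ennreal (dist (T x) x) \<partial>\<mu>)"
    by (subst marg(1)[symmetric], subst nn_integral_distr) auto
  also have "\<dots> = ennreal (\<integral>x. dist (T x) x \<partial>\<mu>)"
    using T\<mu>(1) by (intro nn_integral_eq_integral) auto
  also have "(\<integral>\<^sup>+r. ennreal (dist (T (snd r)) (snd r)) \<partial>\<gamma>) = (\<integral>\<^sup>+x. ennreal (dist (T x) x) \<partial>\<nu>)"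
    by (subst marg(2)[symmetric], subst nn_integral_distr) auto
  also have "\<dots> = ennreal (\<integral>x. dist (T x) x \<partial>\<nu>)"
    using T\<nu>(1) by (intro nn_integral_eq_integral) auto
  also have "(\<integral>\<^sup>+r. ennreal (dist (T (fst r)) (T (snd r))) \<partial>\<gamma>) = ennreal (\<Sum>z\<in>Z \<times> Z. w z * dist (fst z) (snd z))"
    unfolding \<gamma>c using transport_plansD(1)[OF w]
    by (simp add: ennreal_mult mult.commute flip: sum_ennreal)
  also have "ennreal (\<integral>x. dist (T x) x \<partial>\<mu>) + ennreal (\<Sum>z\<in>Z \<times> Z. w z * dist (fst z) (snd z)) + ennreal (\<integral>x. dist (T x) x \<partial>\<nu>)
    \<le> ennreal (e / 4) + ennreal (D + e / 2) + ennreal (e / 4)"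
    using T\<mu>(2) T\<nu>(2) cost by (intro add_mono ennreal_leI) auto
  also have "\<dots> = ennreal (D + e)"
    using D0 e4 by (simp flip: ennreal_plus)
  finally have "(INF \<gamma> \<in> couplings \<mu> \<nu>. \<integral>\<^sup>+ p. ennreal (dist (fst p) (snd p)) \<partial>\<gamma>) \<le> ennreal (D + e)"
    using \<gamma> by (rule INF_lower2[rotated])
  then have "W1 \<mu> \<nu> \<le> enn2ereal (ennreal (D + e))"
    unfolding W1_def by (simp only: less_eq_ennreal.rep_eq)
  then show "W1 \<mu> \<nu> \<le> ereal D + ereal e"
    using D0 e4 by (simp add: enn2ereal_ennreal del: ennreal_plus)
qed

text \<open>The easy half: the pointwise Lipschitz bound is integrated against a coupling. The
  coupling is only nearly optimal, hence the argument with an arbitrary \<open>e\<close>.\<close>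

lemma lipschitz_bound_of_W1:
  fixes \<mu> \<nu> :: "'a::polish_space measure" and \<phi> :: "'a \<Rightarrow> real"
  assumes prob: "prob_space \<mu>" "prob_space \<nu>"
    and i: "integrable \<mu> \<phi>" "integrable \<nu> \<phi>"
    and \<phi>: "L-lipschitz_on UNIV \<phi>" and W: "W1 \<mu> \<nu> \<le> ereal c"
  shows "(\<integral>x. \<phi> x \<partial>\<mu>) - (\<integral>x. \<phi> x \<partial>\<nu>) \<le> L * c"
proof (rule field_le_epsilon)
  fix e :: real assume e: "0 < e"
  have L: "0 \<le> L" using \<phi> by (rule lipschitz_on_nonneg)
  \<comment> \<open>\<open>L + 1\<close> in place of \<open>L\<close> also covers
    \<open>L = 0\<close>.\<close>
  define d where "d = e / (L + 1)"
  have d: "0 < d" "L * d \<le> e" using e L by (auto simp: d_def field_simps)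
  have "0 \<le> W1 \<mu> \<nu>" by (simp add: W1_def)
  then have c0: "0 \<le> c" using W by (metis ereal_less_eq(5) order_trans)
  have "W1 \<mu> \<nu> < ereal (c + d)" using W d by (metis ereal_less_eq(3) less_add_same_cancel1 not_le order_trans)
  then have "enn2ereal (INF \<gamma> \<in> couplings \<mu> \<nu>. \<integral>\<^sup>+ p. ennreal (dist (fst p) (snd p)) \<partial>\<gamma>) < enn2ereal (ennreal (c + d))"
    unfolding W1_def using c0 d enn2ereal_ennreal[of "c + d"] by (simp del: ennreal_plus)
  then have "(INF \<gamma> \<in> couplings \<mu> \<nu>. \<integral>\<^sup>+ p. ennreal (dist (fst p) (snd p)) \<partial>\<gamma>) < ennreal (c + d)"
    by (simp only: less_ennreal.rep_eq)
  then obtain \<gamma> where \<gamma>: "\<gamma> \<in> couplings \<mu> \<nu>" and cost: "(\<integral>\<^sup>+ p. ennreal (dist (fst p) (snd p)) \<partial>\<gamma>) < ennreal (c + d)"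
    by (auto simp: INF_less_iff)
  have s[measurable_cong]: "sets \<gamma> = sets (borel \<Otimes>\<^sub>M borel)" and marg: "distr \<gamma> borel fst = \<mu>" "distr \<gamma> borel snd = \<nu>"
    using \<gamma> by (auto simp: couplings_def)
  note [measurable] = lipschitz_borel_measurable[OF \<phi>]
  have i': "integrable \<gamma> (\<lambda>r. \<phi> (fst r))" "integrable \<gamma> (\<lambda>r. \<phi> (snd r))"
    using i unfolding marg[symmetric] by (simp_all add: integrable_distr_eq)
  have dist: "integrable \<gamma> (\<lambda>r. dist (fst r) (snd r))"
    using cost by (intro integrableI_bounded) (auto intro: less_trans)
  have "(\<integral>x. \<phi> x \<partial>\<mu>) - (\<integral>x. \<phi> x \<partial>\<nu>) = (\<integral>r. \<phi> (fst r) \<partial>\<gamma>) - (\<integral>r. \<phi> (snd r) \<partial>\<gamma>)"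
    unfolding marg[symmetric] by (simp add: integral_distr)
  also have "\<dots> = (\<integral>r. \<phi> (fst r) - \<phi> (snd r) \<partial>\<gamma>)" using i' by simp
  also have "\<dots> \<le> (\<integral>r. L * dist (fst r) (snd r) \<partial>\<gamma>)"
    using i' dist lipschitz_abs_diff_le[OF \<phi>] by (intro integral_mono) (auto simp: abs_le_iff)
  also have "\<dots> = L * (\<integral>r. dist (fst r) (snd r) \<partial>\<gamma>)" by simp
  also have "\<dots> \<le> L * (c + d)"
  proof (rule mult_left_mono[OF _ L])
    have "ennreal (\<integral>r. dist (fst r) (snd r) \<partial>\<gamma>) < ennreal (c + d)"
      using cost nn_integral_eq_integral[OF dist] by simp
    then show "(\<integral>r. dist (fst r) (snd r) \<partial>\<gamma>) \<le> c + d"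
      by (subst (asm) ennreal_less_iff) (auto intro!: integral_nonneg)
  qed
  finally show "(\<integral>x. \<phi> x \<partial>\<mu>) - (\<integral>x. \<phi> x \<partial>\<nu>) \<le> L * c + e" using d by (simp add: distrib_left)
qed

section \<open>Energy estimate for reversible walks\<close>

locale random_walk =
  fixes m :: "'a::polish_space \<Rightarrow> 'a measure"
  assumes mrw: "mrw_space m"
begin

lemma prob_step: "prob_space (m x)" and sets_step[measurable_cong, simp]: "sets (m x) = sets borel"
  and integrable_dist_step: "integrable (m x) (dist x)"
  using mrw unfolding mrw_space_def by blast+

lemma space_step[simp]: "space (m x) = UNIV"
  using sets_eq_imp_space_eq[OF sets_step] by simp

lemma emeasure_step_UNIV[simp]: "emeasure (m x) UNIV = 1"
  using prob_space.emeasure_space_1[OF prob_step, of x] by simp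

text \<open>Recasts the walk as a kernel into the subprobability measures, the form in which
  \<open>bind\<close> and integration against \<open>m x\<close> as a function of \<open>x\<close>
  are available.\<close>

lemma measurable_step[measurable]: "m \<in> measurable borel (subprob_algebra borel)"
proof (rule measurable_subprob_algebra)
  show "(\<lambda>x. emeasure (m x) A) \<in> borel_measurable borel" if "A \<in> sets borel" for A
    using mrw that unfolding mrw_space_def by blast
qed (auto intro: prob_space_imp_subprob_space prob_step)

lemma integrable_step_lipschitz:
  assumes "L-lipschitz_on UNIV (\<phi> :: 'a \<Rightarrow> real)"
  shows "integrable (m x) \<phi>"
  by (rule integrable_lipschitz[OF prob_space.finite_measure[OF prob_step] sets_step integrable_dist_step assms])

lemma measurable_average[measurable]:
  fixes \<phi> :: "'a \<Rightarrow> real"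
  assumes [measurable]: "\<phi> \<in> borel_measurable borel"
  shows "(\<lambda>x. \<integral>y. \<phi> y \<partial>m x) \<in> borel_measurable borel"
  by (rule measurable_compose[OF measurable_step integral_measurable_subprob_algebra[OF assms]])

lemma abs_average_le:
  fixes \<phi> :: "'a \<Rightarrow> real"
  assumes "\<phi> \<in> borel_measurable borel" "\<And>x. \<bar>\<phi> x\<bar> \<le> B"
  shows "\<bar>\<integral>y. \<phi> y \<partial>m x\<bar> \<le> B"
proof -
  interpret prob_space "m x" by (rule prob_step)
  have i: "integrable (m x) \<phi>"
    using assms by (intro integrable_const_bound[where B=B]) auto
  have "\<bar>\<integral>y. \<phi> y \<partial>m x\<bar> \<le> (\<integral>y. \<bar>\<phi> y\<bar> \<partial>m x)" by (rule integral_abs_bound)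
  also have "\<dots> \<le> (\<integral>y. B \<partial>m x)" using i assms by (intro integral_mono) auto
  finally show ?thesis using prob_space by simp
qed

text \<open>Abstracts the energy estimate: invariance of \<^term>\<open>\<mu>\<close> up to \<^term>\<open>K\<close> when tested against bounded
  Lipschitz functions, so that an invariant measure is the case \<^term>\<open>K = 0\<close>.\<close>

definition drift_le :: "'a measure \<Rightarrow> real \<Rightarrow> bool" where
  "drift_le \<mu> K \<longleftrightarrow> (\<forall>L \<phi> B. L-lipschitz_on UNIV \<phi> \<longrightarrow> (\<forall>x. \<bar>\<phi> x\<bar> \<le> B) \<longrightarrow>
     (\<integral>x. \<phi> x \<partial>\<mu>) - (\<integral>x. (\<integral>y. \<phi> y \<partial>m x) \<partial>\<mu>) \<le> L * K)"

lemma drift_leD: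
  assumes "drift_le \<mu> K" "L-lipschitz_on UNIV \<phi>" "\<And>x. \<bar>\<phi> x\<bar> \<le> B"
  shows "(\<integral>x. \<phi> x \<partial>\<mu>) - (\<integral>x. (\<integral>y. \<phi> y \<partial>m x) \<partial>\<mu>) \<le> L * K"
  using assms unfolding drift_le_def by blast

lemma drift_le_nonneg: "drift_le \<mu> K \<Longrightarrow> 0 \<le> K"
  using drift_leD[of \<mu> K 1 "\<lambda>_. 0" 0] by (simp add: lipschitz_on_def)

end

locale reversible_random_walk = random_walk m for m :: "'a::polish_space \<Rightarrow> 'a measure" +
  fixes \<nu> :: "'a measure"
  assumes prob_\<nu>: "prob_space \<nu>" and rev: "reversible_measure m \<nu>"
begin

lemma sets_\<nu>[measurable_cong, simp]: "sets \<nu> = sets borel"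
  using rev by (simp add: reversible_measure_def)

lemma space_\<nu>[simp]: "space \<nu> = UNIV"
  using sets_eq_imp_space_eq[OF sets_\<nu>] by simp

text \<open>The joint law of the current and the next position when the walk starts from
  \<open>\<nu>\<close>; reversibility is its symmetry under exchange of the two.\<close>

definition edges :: "('a \<times> 'a) measure" where
  "edges = \<nu> \<bind> (\<lambda>x. distr (m x) (borel \<Otimes>\<^sub>M borel) (Pair x))"

lemma measurable_edge_kernel:
  "(\<lambda>x. distr (m x) (borel \<Otimes>\<^sub>M borel) (Pair x)) \<in> measurable \<nu> (subprob_algebra (borel \<Otimes>\<^sub>M borel))"
proof -
  have "(\<lambda>x. distr (m x) (borel \<Otimes>\<^sub>M borel) (Pair x)) \<in> measurable borel (subprob_algebra (borel \<Otimes>\<^sub>M borel))"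
    by (rule measurable_distr2[where M=borel]) (auto intro: measurable_step)
  then show ?thesis by simp
qed

lemma sets_edges[measurable_cong, simp]: "sets edges = sets (borel \<Otimes>\<^sub>M borel)"
  unfolding edges_def by (rule sets_bind) auto

lemma nn_integral_edges:
  assumes [measurable]: "F \<in> borel_measurable (borel \<Otimes>\<^sub>M borel)"
  shows "(\<integral>\<^sup>+r. F r \<partial>edges) = (\<integral>\<^sup>+x. (\<integral>\<^sup>+y. F (x, y) \<partial>m x) \<partial>\<nu>)"
  unfolding edges_def
  by (subst nn_integral_bind[OF assms measurable_edge_kernel]) (simp add: nn_integral_distr)

lemma distr_swap_edges: "distr edges (borel \<Otimes>\<^sub>M borel) (\<lambda>r. (snd r, fst r)) = edges"
proof (rule measure_eqI)
  fix C assume "C \<in> sets (distr edges (borel \<Otimes>\<^sub>M borel) (\<lambda>r. (snd r, fst r)))"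
  then have C[measurable]: "C \<in> sets (borel \<Otimes>\<^sub>M borel)" by simp
  have "emeasure (distr edges (borel \<Otimes>\<^sub>M borel) (\<lambda>r. (snd r, fst r))) C
      = (\<integral>\<^sup>+r. indicator C r \<partial>distr edges (borel \<Otimes>\<^sub>M borel) (\<lambda>r. (snd r, fst r)))" by simp
  also have "\<dots> = (\<integral>\<^sup>+r. indicator C (snd r, fst r) \<partial>edges)"
    by (subst nn_integral_distr) auto
  also have "\<dots> = (\<integral>\<^sup>+x. (\<integral>\<^sup>+y. indicator C (y, x) \<partial>m x) \<partial>\<nu>)"
    by (subst nn_integral_edges) auto
  also have "\<dots> = (\<integral>\<^sup>+x. (\<integral>\<^sup>+y. indicator C (x, y) \<partial>m x) \<partial>\<nu>)"
    using bspec[OF conjunct2[OF rev[unfolded reversible_measure_def]] C] by (rule sym)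
  also have "\<dots> = (\<integral>\<^sup>+r. indicator C r \<partial>edges)"
    by (subst nn_integral_edges) auto
  finally show "emeasure (distr edges (borel \<Otimes>\<^sub>M borel) (\<lambda>r. (snd r, fst r))) C = emeasure edges C" by simp
qed simp

lemma nn_integral_edges_swap:
  assumes [measurable]: "F \<in> borel_measurable (borel \<Otimes>\<^sub>M borel)"
  shows "(\<integral>\<^sup>+r. F (snd r, fst r) \<partial>edges) = (\<integral>\<^sup>+r. F r \<partial>edges)"
proof -
  have "(\<integral>\<^sup>+r. F r \<partial>distr edges (borel \<Otimes>\<^sub>M borel) (\<lambda>r. (snd r, fst r))) = (\<integral>\<^sup>+r. F (snd r, fst r) \<partial>edges)"
    by (rule nn_integral_distr) measurable
  then show ?thesis unfolding distr_swap_edges by (rule sym)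
qed

lemma integral_edges_swap:
  fixes F :: "'a \<times> 'a \<Rightarrow> real"
  assumes [measurable]: "F \<in> borel_measurable (borel \<Otimes>\<^sub>M borel)"
  shows "(\<integral>r. F (snd r, fst r) \<partial>edges) = (\<integral>r. F r \<partial>edges)"
proof -
  have "(\<integral>r. F r \<partial>distr edges (borel \<Otimes>\<^sub>M borel) (\<lambda>r. (snd r, fst r))) = (\<integral>r. F (snd r, fst r) \<partial>edges)"
    by (rule integral_distr) measurable
  then show ?thesis unfolding distr_swap_edges by (rule sym)
qed

lemma integrable_edges_swap:
  fixes F :: "'a \<times> 'a \<Rightarrow> real"
  assumes F: "integrable edges F"
  shows "integrable edges (\<lambda>r. F (snd r, fst r))"
proof -
  have "integrable (distr edges (borel \<Otimes>\<^sub>M borel) (\<lambda>r. (snd r, fst r))) F"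
    unfolding distr_swap_edges by (rule F)
  from integrable_distr[OF _ this] show ?thesis by simp
qed

lemma nn_integral_edges_fst:
  assumes [measurable]: "g \<in> borel_measurable borel"
  shows "(\<integral>\<^sup>+r. g (fst r) \<partial>edges) = (\<integral>\<^sup>+x. g x \<partial>\<nu>)"
  by (subst nn_integral_edges) auto

lemma nn_integral_edges_snd:
  assumes [measurable]: "g \<in> borel_measurable borel"
  shows "(\<integral>\<^sup>+r. g (snd r) \<partial>edges) = (\<integral>\<^sup>+x. g x \<partial>\<nu>)"
proof -
  have "(\<integral>\<^sup>+r. g (snd r) \<partial>edges) = (\<integral>\<^sup>+r. g (fst r) \<partial>edges)"
    using nn_integral_edges_swap[of "\<lambda>r. g (fst r)"] by simp
  also have "\<dots> = (\<integral>\<^sup>+x. g x \<partial>\<nu>)" by (rule nn_integral_edges_fst) measurable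
  finally show ?thesis .
qed

text \<open>Both terms are integrals over edges weighted by \<open>f\<close> at the start: the first
  evaluates \<open>\<phi>\<close> at the start, the second at the end. Boundedness of
  \<open>\<phi>\<close> makes each integrable separately.\<close>

lemma integral_density_edges:
  fixes f \<phi> :: "'a \<Rightarrow> real"
  assumes f[measurable]: "f \<in> borel_measurable borel" "\<And>x. 0 \<le> f x" "(\<integral>\<^sup>+x. ennreal (f x) \<partial>\<nu>) = 1"
    and \<phi>[measurable]: "\<phi> \<in> borel_measurable borel" "\<And>x. \<bar>\<phi> x\<bar> \<le> B"
  defines "\<mu> \<equiv> density \<nu> (\<lambda>x. ennreal (f x))"
  shows "integrable edges (\<lambda>r. f (fst r) * (\<phi> (fst r) - \<phi> (snd r)))"
    and "(\<integral>x. \<phi> x \<partial>\<mu>) - (\<integral>x. (\<integral>y. \<phi> y \<partial>m x) \<partial>\<mu>) = (\<integral>r. f (fst r) * (\<phi> (fst r) - \<phi> (snd r)) \<partial>edges)"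
proof -
  \<comment> \<open>shifting by \<^term>\<open>B\<close> makes the integrand nonnegative, so that \<^term>\<open>nn_integral\<close> can be used\<close>
  define \<psi> where "\<psi> = (\<lambda>x. \<phi> x + B)"
  have \<psi>[measurable]: "\<psi> \<in> borel_measurable borel" unfolding \<psi>_def by measurable
  have \<psi>0: "0 \<le> \<psi> x" and \<psi>B: "\<psi> x \<le> 2 * B" for x using \<phi>(2)[of x] by (auto simp: \<psi>_def)
  have s[measurable_cong, simp]: "sets \<mu> = sets borel" by (simp add: \<mu>_def)
  have "prob_space \<mu>"
    by (rule prob_spaceI) (simp add: \<mu>_def emeasure_density f(3))
  then interpret \<mu>: prob_space \<mu> .
  have "(\<integral>\<^sup>+r. ennreal (f (fst r)) \<partial>edges) = 1" using nn_integral_edges_fst[of "\<lambda>x. ennreal (f x)"] f(3) by simp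
  then have "integrable edges (\<lambda>r. f (fst r))"
    using f(2) by (intro integrableI_nonneg) auto
  then have int2: "integrable edges (\<lambda>r. 2 * B * f (fst r))" by simp
  have bd: "\<bar>f x * \<psi> y\<bar> \<le> \<bar>2 * B * f x\<bar>" for x y
  proof -
    have "\<bar>f x * \<psi> y\<bar> = f x * \<psi> y" using f(2) \<psi>0 by simp
    also have "\<dots> \<le> f x * (2 * B)" using f(2) \<psi>B by (intro mult_left_mono)
    finally show ?thesis by (simp add: mult_ac)
  qed
  have int_fst: "integrable edges (\<lambda>r. f (fst r) * \<psi> (fst r))"
    by (rule Bochner_Integration.integrable_bound[OF int2]) (use bd in auto)
  have int_snd: "integrable edges (\<lambda>r. f (fst r) * \<psi> (snd r))"
    by (rule Bochner_Integration.integrable_bound[OF int2]) (use bd in auto)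
  have eq: "f (fst r) * (\<phi> (fst r) - \<phi> (snd r)) = f (fst r) * \<psi> (fst r) - f (fst r) * \<psi> (snd r)" for r
    by (simp add: \<psi>_def algebra_simps)
  show "integrable edges (\<lambda>r. f (fst r) * (\<phi> (fst r) - \<phi> (snd r)))"
    unfolding eq using int_fst int_snd by simp
  have "(\<integral>x. \<psi> x \<partial>\<mu>) = enn2real (\<integral>\<^sup>+x. ennreal (\<psi> x) \<partial>\<mu>)"
    using \<psi>0 by (intro integral_eq_nn_integral) auto
  also have "(\<integral>\<^sup>+x. ennreal (\<psi> x) \<partial>\<mu>) = (\<integral>\<^sup>+x. ennreal (f x * \<psi> x) \<partial>\<nu>)"
    using f(2) \<psi>0 by (simp add: \<mu>_def nn_integral_density ennreal_mult)
  also have "\<dots> = (\<integral>\<^sup>+r. ennreal (f (fst r) * \<psi> (fst r)) \<partial>edges)"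
    by (simp add: nn_integral_edges_fst[of "\<lambda>x. ennreal (f x * \<psi> x)"])
  also have "enn2real \<dots> = (\<integral>r. f (fst r) * \<psi> (fst r) \<partial>edges)"
    using f(2) \<psi>0 by (intro integral_eq_nn_integral[symmetric]) auto
  finally have 1: "(\<integral>x. \<psi> x \<partial>\<mu>) = (\<integral>r. f (fst r) * \<psi> (fst r) \<partial>edges)" .
  have \<psi>m: "integrable (m x) \<psi>" for x
    using prob_step \<psi>0 \<psi>B
    by (intro finite_measure.integrable_const_bound[where B="2*B"]) (auto simp: prob_space.finite_measure)
  have "(\<integral>x. (\<integral>y. \<psi> y \<partial>m x) \<partial>\<mu>) = enn2real (\<integral>\<^sup>+x. ennreal (\<integral>y. \<psi> y \<partial>m x) \<partial>\<mu>)"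
    using \<psi>0 by (intro integral_eq_nn_integral) (auto intro!: integral_nonneg)
  also have "(\<integral>\<^sup>+x. ennreal (\<integral>y. \<psi> y \<partial>m x) \<partial>\<mu>) = (\<integral>\<^sup>+x. (\<integral>\<^sup>+y. ennreal (f x * \<psi> y) \<partial>m x) \<partial>\<nu>)"
    unfolding \<mu>_def using f(2) \<psi>0
    by (subst nn_integral_density) (auto simp: ennreal_mult nn_integral_cmult nn_integral_eq_integral[OF \<psi>m])
  also have "\<dots> = (\<integral>\<^sup>+r. ennreal (f (fst r) * \<psi> (snd r)) \<partial>edges)"
    by (subst nn_integral_edges) auto
  also have "enn2real \<dots> = (\<integral>r. f (fst r) * \<psi> (snd r) \<partial>edges)"
    using f(2) \<psi>0 by (intro integral_eq_nn_integral[symmetric]) auto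
  finally have 2: "(\<integral>x. (\<integral>y. \<psi> y \<partial>m x) \<partial>\<mu>) = (\<integral>r. f (fst r) * \<psi> (snd r) \<partial>edges)" .
  have "integrable \<mu> \<phi>" using \<phi> by (intro \<mu>.integrable_const_bound[where B=B]) auto
  then have 3: "(\<integral>x. \<psi> x \<partial>\<mu>) = (\<integral>x. \<phi> x \<partial>\<mu>) + B" by (simp add: \<psi>_def \<mu>.prob_space)
  have "integrable (m x) \<phi>" for x
    using prob_step \<phi>
    by (intro finite_measure.integrable_const_bound[where B=B]) (auto simp: prob_space.finite_measure)
  then have "(\<integral>y. \<psi> y \<partial>m x) = (\<integral>y. \<phi> y \<partial>m x) + (\<integral>y. B \<partial>m x)" for x
    unfolding \<psi>_def
    by (rule Bochner_Integration.integral_add)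
      (rule finite_measure.integrable_const[OF prob_space.finite_measure[OF prob_step]])
  then have "(\<integral>y. \<psi> y \<partial>m x) = (\<integral>y. \<phi> y \<partial>m x) + B" for x
    using prob_space.prob_space[OF prob_step, of x] by simp
  moreover have "integrable \<mu> (\<lambda>x. \<integral>y. \<phi> y \<partial>m x)"
    using abs_average_le[OF \<phi>] by (intro \<mu>.integrable_const_bound[where B=B]) auto
  ultimately have 4: "(\<integral>x. (\<integral>y. \<psi> y \<partial>m x) \<partial>\<mu>) = (\<integral>x. (\<integral>y. \<phi> y \<partial>m x) \<partial>\<mu>) + B"
    by (simp add: \<mu>.prob_space)
  have "(\<integral>r. f (fst r) * (\<phi> (fst r) - \<phi> (snd r)) \<partial>edges)
      = (\<integral>r. f (fst r) * \<psi> (fst r) \<partial>edges) - (\<integral>r. f (fst r) * \<psi> (snd r) \<partial>edges)"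
    unfolding eq using int_fst int_snd by (rule Bochner_Integration.integral_diff)
  then show "(\<integral>x. \<phi> x \<partial>\<mu>) - (\<integral>x. (\<integral>y. \<phi> y \<partial>m x) \<partial>\<mu>) = (\<integral>r. f (fst r) * (\<phi> (fst r) - \<phi> (snd r)) \<partial>edges)"
    using 1 2 3 4 by linarith
qed

text \<open>Real bounds \<open>\<Theta>\<close> and \<open>I\<close> replace the exact constants, so
  that \<open>f = 1\<close> with \<open>I = 0\<close> is an instance and expresses invariance of
  \<open>\<nu>\<close>.\<close>

lemma drift_le_energy:
  fixes f :: "'a \<Rightarrow> real"
  assumes f[measurable]: "f \<in> borel_measurable borel" "\<And>x. 0 \<le> f x" "(\<integral>\<^sup>+x. ennreal (f x) \<partial>\<nu>) = 1"
    and \<Theta>: "AE x in \<nu>. (\<integral>\<^sup>+y. ennreal ((dist x y)\<^sup>2) \<partial>m x) \<le> ennreal (2 * \<Theta>)" "0 \<le> \<Theta>"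
    and I: "(\<integral>\<^sup>+x. (\<integral>\<^sup>+y. ennreal ((sqrt (f y) - sqrt (f x))\<^sup>2) \<partial>m x) \<partial>\<nu>) \<le> ennreal I" "0 \<le> I"
  shows "drift_le (density \<nu> (\<lambda>x. ennreal (f x))) (sqrt (2 * \<Theta>) * sqrt I)"
  unfolding drift_le_def
proof (intro allI impI)
  fix L B and \<phi> :: "'a \<Rightarrow> real" assume lip: "L-lipschitz_on UNIV \<phi>" and "\<forall>x. \<bar>\<phi> x\<bar> \<le> B"
  then have B: "\<bar>\<phi> x\<bar> \<le> B" for x by simp
  note \<phi>[measurable] = lipschitz_borel_measurable[OF lip]
  note L = lipschitz_on_nonneg[OF lip]
  note J = integral_density_edges[OF f \<phi> B]
  let ?J = "\<integral>r. f (fst r) * (\<phi> (fst r) - \<phi> (snd r)) \<partial>edges"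
  let ?s = "\<lambda>r. \<bar>sqrt (f (fst r)) - sqrt (f (snd r))\<bar>"
  let ?t = "\<lambda>r. (sqrt (f (fst r)) + sqrt (f (snd r))) * dist (fst r) (snd r)"
  \<comment> \<open>Exchanging the two ends of an edge preserves the integral; the sum of both
    versions is the product of the increments of \<open>f\<close> and \<open>\<phi>\<close>.\<close>
  have Js: "integrable edges (\<lambda>r. f (snd r) * (\<phi> (snd r) - \<phi> (fst r)))"
    "(\<integral>r. f (snd r) * (\<phi> (snd r) - \<phi> (fst r)) \<partial>edges) = ?J"
    using integrable_edges_swap[OF J(1)] integral_edges_swap[of "\<lambda>r. f (fst r) * (\<phi> (fst r) - \<phi> (snd r))"] by simp_all
  have J2: "2 * ?J = (\<integral>r. f (fst r) * (\<phi> (fst r) - \<phi> (snd r)) + f (snd r) * (\<phi> (snd r) - \<phi> (fst r)) \<partial>edges)"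
    using J(1) Js by simp
  define X where "X = (\<integral>\<^sup>+r. ennreal (?s r) * ennreal (?t r) \<partial>edges)"
  have "ennreal \<bar>2 * ?J\<bar> \<le> (\<integral>\<^sup>+r. ennreal \<bar>f (fst r) * (\<phi> (fst r) - \<phi> (snd r)) + f (snd r) * (\<phi> (snd r) - \<phi> (fst r))\<bar> \<partial>edges)"
    unfolding J2 using integral_norm_bound_ennreal[OF Bochner_Integration.integrable_add[OF J(1) Js(1)]] by simp
  also have "\<dots> \<le> (\<integral>\<^sup>+r. ennreal L * (ennreal (?s r) * ennreal (?t r)) \<partial>edges)"
  proof (rule nn_integral_mono)
    fix r
    have "\<bar>f (fst r) * (\<phi> (fst r) - \<phi> (snd r)) + f (snd r) * (\<phi> (snd r) - \<phi> (fst r))\<bar>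
       = \<bar>f (fst r) - f (snd r)\<bar> * \<bar>\<phi> (fst r) - \<phi> (snd r)\<bar>"
      unfolding abs_mult[symmetric] by (simp add: algebra_simps)
    also have "\<dots> \<le> \<bar>f (fst r) - f (snd r)\<bar> * (L * dist (fst r) (snd r))"
      by (intro mult_left_mono lipschitz_abs_diff_le[OF lip]) simp
    also have "f (fst r) - f (snd r) = (sqrt (f (fst r)) - sqrt (f (snd r))) * (sqrt (f (fst r)) + sqrt (f (snd r)))"
      using f(2) by (simp add: algebra_simps)
    also have "\<bar>\<dots>\<bar> = ?s r * (sqrt (f (fst r)) + sqrt (f (snd r)))"
      using f(2) by (simp add: abs_mult)
    finally have "\<bar>f (fst r) * (\<phi> (fst r) - \<phi> (snd r)) + f (snd r) * (\<phi> (snd r) - \<phi> (fst r))\<bar> \<le> L * (?s r * ?t r)"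
      by (simp add: mult_ac)
    then show "ennreal \<bar>f (fst r) * (\<phi> (fst r) - \<phi> (snd r)) + f (snd r) * (\<phi> (snd r) - \<phi> (fst r))\<bar>
        \<le> ennreal L * (ennreal (?s r) * ennreal (?t r))"
      using L f(2) by (simp flip: ennreal_mult add: ennreal_leI)
  qed
  also have "\<dots> = ennreal L * X" unfolding X_def by (intro nn_integral_cmult) measurable
  finally have JX: "ennreal \<bar>2 * ?J\<bar> \<le> ennreal L * X" .
  have sb: "(\<integral>\<^sup>+r. (ennreal (?s r))\<^sup>2 \<partial>edges) \<le> ennreal I"
  proof -
    have "(\<integral>\<^sup>+r. (ennreal (?s r))\<^sup>2 \<partial>edges) = (\<integral>\<^sup>+x. (\<integral>\<^sup>+y. ennreal ((sqrt (f y) - sqrt (f x))\<^sup>2) \<partial>m x) \<partial>\<nu>)"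
      by (subst nn_integral_edges) (auto simp: ennreal_power power2_commute)
    with I(1) show ?thesis by simp
  qed
  have tb: "(\<integral>\<^sup>+r. (ennreal (?t r))\<^sup>2 \<partial>edges) \<le> ennreal (8 * \<Theta>)"
  proof -
    have "(\<integral>\<^sup>+r. ennreal (f (fst r) * (dist (fst r) (snd r))\<^sup>2) \<partial>edges)
        = (\<integral>\<^sup>+x. ennreal (f x) * (\<integral>\<^sup>+y. ennreal ((dist x y)\<^sup>2) \<partial>m x) \<partial>\<nu>)"
      using f(2) by (subst nn_integral_edges) (auto simp: ennreal_mult nn_integral_cmult)
    also have "\<dots> \<le> (\<integral>\<^sup>+x. ennreal (f x) * ennreal (2 * \<Theta>) \<partial>\<nu>)"
      using \<Theta>(1) by (intro nn_integral_mono_AE) (auto elim!: eventually_mono intro: mult_left_mono)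
    also have "\<dots> = ennreal (2 * \<Theta>)" by (simp add: nn_integral_multc f(3))
    finally have 1: "(\<integral>\<^sup>+r. ennreal (f (fst r) * (dist (fst r) (snd r))\<^sup>2) \<partial>edges) \<le> ennreal (2 * \<Theta>)" .
    \<comment> \<open>The swap moves the weight \<open>f\<close> from the end of the edge to its
      start, where the second moment bound holds almost everywhere.\<close>
    have 2: "(\<integral>\<^sup>+r. ennreal (f (snd r) * (dist (fst r) (snd r))\<^sup>2) \<partial>edges) \<le> ennreal (2 * \<Theta>)"
      using 1 nn_integral_edges_swap[of "\<lambda>r. ennreal (f (fst r) * (dist (fst r) (snd r))\<^sup>2)"]
      by (simp add: dist_commute)
    have "(\<integral>\<^sup>+r. (ennreal (?t r))\<^sup>2 \<partial>edges) \<le> (\<integral>\<^sup>+r. ennreal 2 * ennreal (f (fst r) * (dist (fst r) (snd r))\<^sup>2)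
        + ennreal 2 * ennreal (f (snd r) * (dist (fst r) (snd r))\<^sup>2) \<partial>edges)"
    proof (rule nn_integral_mono)
      fix r
      have "0 \<le> (sqrt (f (fst r)) - sqrt (f (snd r)))\<^sup>2" by simp
      then have "(sqrt (f (fst r)) + sqrt (f (snd r)))\<^sup>2 \<le> 2 * f (fst r) + 2 * f (snd r)"
        using f(2) by (simp add: power2_sum power2_diff)
      then have "(?t r)\<^sup>2 \<le> (2 * f (fst r) + 2 * f (snd r)) * (dist (fst r) (snd r))\<^sup>2"
        unfolding power_mult_distrib by (intro mult_right_mono) auto
      then have "ennreal ((?t r)\<^sup>2) \<le> ennreal (2 * (f (fst r) * (dist (fst r) (snd r))\<^sup>2) + 2 * (f (snd r) * (dist (fst r) (snd r))\<^sup>2))"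
        by (intro ennreal_leI) (simp add: algebra_simps)
      also have "\<dots> = ennreal 2 * ennreal (f (fst r) * (dist (fst r) (snd r))\<^sup>2)
          + ennreal 2 * ennreal (f (snd r) * (dist (fst r) (snd r))\<^sup>2)"
        using f(2) by (subst ennreal_plus, simp, simp, (subst ennreal_mult, simp, simp)+, simp)
      finally show "(ennreal (?t r))\<^sup>2 \<le> ennreal 2 * ennreal (f (fst r) * (dist (fst r) (snd r))\<^sup>2)
          + ennreal 2 * ennreal (f (snd r) * (dist (fst r) (snd r))\<^sup>2)"
        using f(2) by (subst ennreal_power) auto
    qed
    also have "\<dots> = ennreal 2 * (\<integral>\<^sup>+r. ennreal (f (fst r) * (dist (fst r) (snd r))\<^sup>2) \<partial>edges)
        + ennreal 2 * (\<integral>\<^sup>+r. ennreal (f (snd r) * (dist (fst r) (snd r))\<^sup>2) \<partial>edges)"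
      by (simp add: nn_integral_add nn_integral_cmult del: ennreal_numeral)
    also have "\<dots> \<le> ennreal 2 * ennreal (2 * \<Theta>) + ennreal 2 * ennreal (2 * \<Theta>)"
      using 1 2 by (intro add_mono mult_left_mono) auto
    also have "\<dots> = ennreal (8 * \<Theta>)"
      using \<Theta>(2) by (simp add: ennreal_mult[symmetric] ennreal_plus[symmetric] del: ennreal_plus ennreal_numeral)
    finally show ?thesis .
  qed
  have "X\<^sup>2 \<le> (\<integral>\<^sup>+r. (ennreal (?s r))\<^sup>2 \<partial>edges) * (\<integral>\<^sup>+r. (ennreal (?t r))\<^sup>2 \<partial>edges)"
    unfolding X_def by (rule Cauchy_Schwarz_nn_integral) measurable
  also have "\<dots> \<le> ennreal I * ennreal (8 * \<Theta>)"
    using sb tb by (intro mult_mono) auto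
  finally have "X\<^sup>2 \<le> ennreal I * ennreal (8 * \<Theta>)" .
  then have X2: "X\<^sup>2 \<le> ennreal (8 * \<Theta> * I)" using I(2) \<Theta>(2) by (simp add: ennreal_mult mult.commute)
  have "X \<le> ennreal (sqrt (8 * \<Theta> * I))"
  proof (cases X)
    case (real x)
    then have "x\<^sup>2 \<le> 8 * \<Theta> * I" using X2 I(2) \<Theta>(2) by (simp add: ennreal_power)
    then show ?thesis using real by (auto intro!: ennreal_leI real_le_rsqrt)
  next
    case top
    then show ?thesis using X2 by (simp add: power2_eq_square top_unique)
  qed
  then have "ennreal \<bar>2 * ?J\<bar> \<le> ennreal L * ennreal (sqrt (8 * \<Theta> * I))"
    by (rule order_trans[OF JX mult_left_mono]) simp
  also have "\<dots> = ennreal (L * sqrt (8 * \<Theta> * I))" using L I(2) \<Theta>(2) by (simp add: ennreal_mult)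
  finally have "\<bar>2 * ?J\<bar> \<le> L * sqrt (8 * \<Theta> * I)" using L I(2) \<Theta>(2) by (subst (asm) ennreal_le_iff) auto
  moreover have sqrt8: "sqrt (8 * \<Theta> * I) = 2 * (sqrt (2 * \<Theta>) * sqrt I)"
    using real_sqrt_mult[of "2\<^sup>2" "2 * \<Theta> * I"] by (simp add: real_sqrt_mult[symmetric] mult_ac)
  moreover have "L * sqrt (8 * \<Theta> * I) = 2 * (L * (sqrt (2 * \<Theta>) * sqrt I))"
    unfolding sqrt8 by simp
  ultimately have "?J \<le> L * (sqrt (2 * \<Theta>) * sqrt I)" by linarith
  then show "(\<integral>x. \<phi> x \<partial>density \<nu> (\<lambda>x. ennreal (f x))) - (\<integral>x. (\<integral>y. \<phi> y \<partial>m x) \<partial>density \<nu> (\<lambda>x. ennreal (f x)))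
      \<le> L * (sqrt (2 * \<Theta>) * sqrt I)"
    unfolding J(2) .
qed

end

section \<open>Positive curvature\<close>

text \<open>The bound \<open>\<kappa> \<le> 1\<close> makes \<open>1 - \<kappa>\<close> admissible
  as a Lipschitz constant.\<close>

locale contracting_random_walk = random_walk m for m :: "'a::polish_space \<Rightarrow> 'a measure" +
  fixes \<kappa> :: real
  assumes \<kappa>: "0 < \<kappa>" "\<kappa> \<le> 1"
    and contraction: "W1 (m x) (m y) \<le> ereal ((1 - \<kappa>) * dist x y)"
begin

lemma average_lipschitz:
  fixes \<phi> :: "'a \<Rightarrow> real"
  assumes \<phi>: "L-lipschitz_on UNIV \<phi>"
  shows "(L * (1 - \<kappa>))-lipschitz_on UNIV (\<lambda>x. \<integral>y. \<phi> y \<partial>m x)"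
proof (rule lipschitz_onI)
  have *: "(\<integral>z. \<phi> z \<partial>m x) - (\<integral>z. \<phi> z \<partial>m y) \<le> L * ((1 - \<kappa>) * dist x y)" for x y
    by (rule lipschitz_bound_of_W1[OF prob_step prob_step integrable_step_lipschitz[OF \<phi>] integrable_step_lipschitz[OF \<phi>] \<phi> contraction])
  fix x y
  show "dist (\<integral>z. \<phi> z \<partial>m x) (\<integral>z. \<phi> z \<partial>m y) \<le> L * (1 - \<kappa>) * dist x y"
    using *[of x y] *[of y x] by (simp add: dist_real_def abs_le_iff dist_commute mult_ac)
qed (use lipschitz_on_nonneg[OF \<phi>] \<kappa> in simp)

text \<open>Lyapunov argument: contraction gives P d \<le> (1 - \<kappa>) d + C for the distance d
  to \<open>x0\<close>, while the drift bound says that d - P d has integral at most K; formally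
  \<kappa> times the integral of d is at most K + C. As d is unbounded, the argument is run on
  truncations.\<close>

lemma integrable_dist_of_drift:
  assumes "prob_space \<mu>" and s[measurable_cong]: "sets \<mu> = sets borel" and drift: "drift_le \<mu> K"
  shows "integrable \<mu> (dist x0)"
proof -
  interpret \<mu>: prob_space \<mu> by fact
  define C where "C = (\<integral>y. dist x0 y \<partial>m x0)"
  have C0: "0 \<le> C" unfolding C_def by (rule Bochner_Integration.integral_nonneg) simp
  define b where "b = (\<lambda>x. (1 - \<kappa>) * dist x0 x + C)"
  have avg: "(\<integral>y. dist x0 y \<partial>m x) \<le> b x" for x
    using lipschitz_abs_diff_le[OF average_lipschitz[OF dist_lipschitz[of x0]], of x x0]
    by (simp add: b_def C_def abs_le_iff dist_commute)
  have b0: "0 \<le> b x" for x using C0 \<kappa> by (simp add: b_def)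
  define \<phi> where "\<phi> = (\<lambda>n x. min (dist x0 x) (real n))"
  \<comment> \<open>the drift bound for the truncated distance, combined with Fatou's lemma as the truncation is lifted\<close>
  define h where "h = (\<lambda>n x. \<phi> n x - min (b x) (real n) + C)"
  have b_meas[measurable]: "b \<in> borel_measurable borel" unfolding b_def by measurable
  have \<phi>_meas[measurable]: "\<phi> n \<in> borel_measurable borel" for n unfolding \<phi>_def by measurable
  have h_meas[measurable]: "h n \<in> borel_measurable borel" for n unfolding h_def by measurable
  have \<phi>_lip: "1-lipschitz_on UNIV (\<phi> n)" for n
  proof (rule lipschitz_onI)
    fix x y show "dist (\<phi> n x) (\<phi> n y) \<le> 1 * dist x y"
      using lipschitz_abs_diff_le[OF dist_lipschitz[of x0], of x y] by (auto simp: \<phi>_def dist_real_def)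
  qed simp
  have \<phi>_bdd: "\<bar>\<phi> n x\<bar> \<le> real n" for n x by (simp add: \<phi>_def)
  \<comment> \<open>Since b \<le> d + C, truncating at \<open>n\<close> preserves the inequality up
    to \<open>C\<close>. The summand \<open>C\<close> in \<open>h\<close> is there for this sign,
    which Fatou's lemma requires.\<close>
  have h0: "0 \<le> h n x" for n x
  proof -
    have "0 \<le> \<kappa> * dist x0 x" "0 \<le> (1 - \<kappa>) * dist x0 x" using \<kappa> by simp_all
    then show ?thesis using C0 unfolding h_def \<phi>_def b_def by (auto simp: algebra_simps min_def)
  qed
  have h_int: "(\<integral>x. h n x \<partial>\<mu>) \<le> K + C" for n
  proof -
    have i1: "integrable \<mu> (\<phi> n)"
      using \<phi>_bdd by (intro \<mu>.integrable_const_bound[where B="real n"]) auto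
    have i2: "integrable \<mu> (\<lambda>x. min (b x) (real n))"
      using b0 by (intro \<mu>.integrable_const_bound[where B="real n"]) auto
    have i3: "integrable \<mu> (\<lambda>x. \<integral>y. \<phi> n y \<partial>m x)"
      using abs_average_le[OF \<phi>_meas \<phi>_bdd]
      by (intro \<mu>.integrable_const_bound[where B="real n"]) auto
    have "(\<integral>y. \<phi> n y \<partial>m x) \<le> min (b x) (real n)" for x
    proof -
      have "(\<integral>y. \<phi> n y \<partial>m x) \<le> (\<integral>y. dist x0 y \<partial>m x)"
        by (intro integral_mono integrable_step_lipschitz[OF \<phi>_lip] integrable_step_lipschitz[OF dist_lipschitz])
          (simp add: \<phi>_def)
      moreover have "(\<integral>y. \<phi> n y \<partial>m x) \<le> real n"
        using abs_average_le[OF \<phi>_meas[of n] \<phi>_bdd[of n], of x] by simp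
      ultimately show ?thesis using avg[of x] by simp
    qed
    then have "(\<integral>x. (\<integral>y. \<phi> n y \<partial>m x) \<partial>\<mu>) \<le> (\<integral>x. min (b x) (real n) \<partial>\<mu>)"
      by (intro integral_mono i2 i3)
    moreover have "(\<integral>x. h n x \<partial>\<mu>) = (\<integral>x. \<phi> n x \<partial>\<mu>) - (\<integral>x. min (b x) (real n) \<partial>\<mu>) + C"
      using i1 i2 by (simp add: h_def \<mu>.prob_space)
    moreover have "(\<integral>x. \<phi> n x \<partial>\<mu>) - (\<integral>x. (\<integral>y. \<phi> n y \<partial>m x) \<partial>\<mu>) \<le> K"
      using drift_leD[OF drift \<phi>_lip \<phi>_bdd, of n] by simp
    ultimately show ?thesis by linarith
  qed
  have h_nn: "(\<integral>\<^sup>+x. ennreal (h n x) \<partial>\<mu>) \<le> ennreal (K + C)" for n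
  proof -
    have "h n x \<le> real n + C" for x using b0[of x] by (simp add: h_def \<phi>_def min_def)
    then have "integrable \<mu> (h n)"
      using h0 by (intro \<mu>.integrable_const_bound[where B="real n + C"]) auto
    then have "(\<integral>\<^sup>+x. ennreal (h n x) \<partial>\<mu>) = ennreal (\<integral>x. h n x \<partial>\<mu>)"
      using h0 by (intro nn_integral_eq_integral) auto
    then show ?thesis using h_int by (simp add: ennreal_leI)
  qed
  \<comment> \<open>For large \<open>n\<close> neither truncation is active and \<open>h n x\<close>
    equals \<open>\<kappa> * dist x0 x\<close>, so the sequence is eventually constant.\<close>
  have lim: "liminf (\<lambda>n. ennreal (h n x)) = ennreal (\<kappa> * dist x0 x)" for x
  proof -
    obtain N where N: "max (dist x0 x) (b x) \<le> real N" using real_arch_simple by blast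
    have "h n x = \<kappa> * dist x0 x" if "N \<le> n" for n
    proof -
      have "dist x0 x \<le> real n" "b x \<le> real n" using N that by (auto intro: order_trans)
      then show ?thesis by (simp add: h_def \<phi>_def min_def) (simp add: b_def algebra_simps)
    qed
    then have "\<forall>\<^sub>F n in sequentially. ennreal (h n x) = ennreal (\<kappa> * dist x0 x)"
      by (intro eventually_sequentiallyI[of N]) simp
    then have "(\<lambda>n. ennreal (h n x)) \<longlonglongrightarrow> ennreal (\<kappa> * dist x0 x)"
      by (rule tendsto_eventually)
    then show ?thesis by (intro lim_imp_Liminf) auto
  qed
  have "(\<integral>\<^sup>+x. ennreal (\<kappa> * dist x0 x) \<partial>\<mu>) = (\<integral>\<^sup>+x. liminf (\<lambda>n. ennreal (h n x)) \<partial>\<mu>)"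
    by (simp only: lim)
  also have "\<dots> \<le> liminf (\<lambda>n. \<integral>\<^sup>+x. ennreal (h n x) \<partial>\<mu>)"
    by (rule nn_integral_liminf) measurable
  also have "\<dots> \<le> ennreal (K + C)"
    using h_nn by (intro Liminf_le) auto
  finally have "(\<integral>\<^sup>+x. ennreal (\<kappa> * dist x0 x) \<partial>\<mu>) < \<infinity>"
    by (rule order_le_less_trans) simp
  then have "integrable \<mu> (\<lambda>x. \<kappa> * dist x0 x)"
    using \<kappa> by (intro integrableI_nonneg) auto
  then show ?thesis using \<kappa> by simp
qed

theorem W1_le_of_drift:
  assumes "prob_space \<mu>" "prob_space \<nu>" and s[measurable_cong]: "sets \<mu> = sets borel" "sets \<nu> = sets borel"
    and drift: "drift_le \<mu> K" and inv: "drift_le \<nu> 0"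
  shows "W1 \<mu> \<nu> \<le> ereal (K / \<kappa>)"
proof -
  interpret \<mu>: prob_space \<mu> by fact
  interpret \<nu>: prob_space \<nu> by fact
  define x0 where "x0 = (undefined :: 'a)"
  have i: "integrable \<mu> (dist x0)" "integrable \<nu> (dist x0)"
    using integrable_dist_of_drift[OF assms(1) s(1) drift] integrable_dist_of_drift[OF assms(2) s(2) inv] by auto
  define R where "R = (\<integral>x. dist x0 x \<partial>\<mu>) + (\<integral>x. dist x0 x \<partial>\<nu>)"
  have K: "0 \<le> K" using drift by (rule drift_le_nonneg)
  \<comment> \<open>\<open>K / \<kappa>\<close> is the fixed point of c \<mapsto> K + (1 - \<kappa>)
    c, so the induction carries a closed form rather than partial geometric sums. \<open>R\<close>
    bounds the difference for 1-Lipschitz functions at the start and is finite by the first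
    moments.\<close>
  have iter: "(\<integral>x. \<phi> x \<partial>\<mu>) - (\<integral>x. \<phi> x \<partial>\<nu>) \<le> L * (K / \<kappa> + (1 - \<kappa>) ^ n * R)"
    if "L-lipschitz_on UNIV \<phi>" "\<And>x. \<bar>\<phi> x\<bar> \<le> B" for L B n and \<phi> :: "'a \<Rightarrow> real"
    using that
  proof (induction n arbitrary: L B \<phi>)
    case 0
    note lip = 0(1)
    have L: "0 \<le> L" using lip by (rule lipschitz_on_nonneg)
    have j: "integrable \<mu> \<phi>" "integrable \<nu> \<phi>"
      using integrable_lipschitz[OF \<mu>.finite_measure_axioms s(1) i(1) lip]
        integrable_lipschitz[OF \<nu>.finite_measure_axioms s(2) i(2) lip] .
    have bd: "\<phi> x \<le> \<phi> x0 + L * dist x0 x" "\<phi> x0 - L * dist x0 x \<le> \<phi> x" for x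
      using lipschitz_abs_diff_le[OF lip, of x x0] by (auto simp: abs_le_iff dist_commute)
    have "(\<integral>x. \<phi> x \<partial>\<mu>) \<le> (\<integral>x. \<phi> x0 + L * dist x0 x \<partial>\<mu>)"
      using i j bd by (intro integral_mono) auto
    moreover have "(\<integral>x. \<phi> x0 - L * dist x0 x \<partial>\<nu>) \<le> (\<integral>x. \<phi> x \<partial>\<nu>)"
      using i j bd by (intro integral_mono) auto
    ultimately have "(\<integral>x. \<phi> x \<partial>\<mu>) - (\<integral>x. \<phi> x \<partial>\<nu>) \<le> L * R"
      using i by (simp add: R_def \<mu>.prob_space \<nu>.prob_space algebra_simps)
    also have "\<dots> \<le> L * (K / \<kappa> + R)" using L K \<kappa> by (intro mult_left_mono) auto
    finally show ?case by simp
  next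
    case (Suc n)
    note lip = Suc.prems(1)
    let ?P = "\<lambda>x. \<integral>y. \<phi> y \<partial>m x"
    have "(\<integral>x. \<phi> x \<partial>\<mu>) - (\<integral>x. ?P x \<partial>\<mu>) \<le> L * K"
      by (rule drift_leD[OF drift Suc.prems])
    \<comment> \<open>The drift bound of \<open>\<nu>\<close> for \<open>- \<phi>\<close> gives the
      inequality in the direction needed here.\<close>
    moreover have "(\<integral>x. ?P x \<partial>\<nu>) \<le> (\<integral>x. \<phi> x \<partial>\<nu>)"
      using drift_leD[OF inv, of L "\<lambda>x. - \<phi> x" B] Suc.prems by simp
    moreover have "(\<integral>x. ?P x \<partial>\<mu>) - (\<integral>x. ?P x \<partial>\<nu>) \<le> (L * (1 - \<kappa>)) * (K / \<kappa> + (1 - \<kappa>) ^ n * R)"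
      by (rule Suc.IH[OF average_lipschitz[OF lip] abs_average_le[OF lipschitz_borel_measurable[OF lip] Suc.prems(2)]])
    ultimately have "(\<integral>x. \<phi> x \<partial>\<mu>) - (\<integral>x. \<phi> x \<partial>\<nu>) \<le> L * K + (L * (1 - \<kappa>)) * (K / \<kappa> + (1 - \<kappa>) ^ n * R)"
      by linarith
    also have "\<dots> = L * (K / \<kappa> + (1 - \<kappa>) ^ Suc n * R)"
      using \<kappa> by (simp add: field_simps)
    finally show ?case .
  qed
  show ?thesis
  proof (rule W1_le_of_lipschitz_bound[OF assms(1,2) s i])
    fix \<phi> :: "'a \<Rightarrow> real" and B assume \<phi>: "1-lipschitz_on UNIV \<phi>" "\<And>x. \<bar>\<phi> x\<bar> \<le> B"
    have "(\<lambda>n. K / \<kappa> + (1 - \<kappa>) ^ n * R) \<longlonglongrightarrow> K / \<kappa> + 0 * R"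
      using \<kappa> by (intro tendsto_intros LIMSEQ_realpow_zero) auto
    then show "(\<integral>x. \<phi> x \<partial>\<mu>) - (\<integral>x. \<phi> x \<partial>\<nu>) \<le> K / \<kappa>"
      using iter[OF \<phi>] by (intro LIMSEQ_le_const[where X="\<lambda>n. K / \<kappa> + (1 - \<kappa>) ^ n * R"]) auto
  qed
qed

end

section \<open>From the extended-real quantities to real constants, and the conclusion\<close>

lemma W1_nonneg: "0 \<le> W1 \<mu> \<nu>"
  by (simp add: W1_def)

lemma W1_subsingleton:
  fixes \<mu> \<nu> :: "'a::polish_space measure"
  assumes eq: "\<And>x y :: 'a. x = y" and prob: "prob_space \<mu>" "prob_space \<nu>"
    and s: "sets \<mu> = sets borel" "sets \<nu> = sets borel"
  shows "W1 \<mu> \<nu> = 0"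
proof -
  interpret \<mu>: prob_space \<mu> by fact
  interpret \<nu>: prob_space \<nu> by fact
  fix x0 :: 'a
  have const: "\<phi> = (\<lambda>_. \<phi> x0)" for \<phi> :: "'a \<Rightarrow> real" using eq by (metis (full_types))
  have "W1 \<mu> \<nu> \<le> ereal 0"
  proof (rule W1_le_of_lipschitz_bound[OF prob s, of x0])
    show "integrable \<mu> (dist x0)" "integrable \<nu> (dist x0)"
      by (subst const, simp)+
    fix \<phi> :: "'a \<Rightarrow> real" and B :: real
    show "(\<integral>x. \<phi> x \<partial>\<mu>) - (\<integral>x. \<phi> x \<partial>\<nu>) \<le> 0"
      by (subst (1 2) const) (simp add: \<mu>.prob_space \<nu>.prob_space)
  qed
  then show ?thesis using W1_nonneg[of \<mu> \<nu>] by (simp add: zero_ereal_def[symmetric])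
qed

lemma ricci_curv_le:
  assumes "x \<noteq> y"
  shows "ricci_curv m \<le> 1 - W1 (m x) (m y) / ereal (dist x y)"
  unfolding ricci_curv_def by (rule INF_lower2[of "(x, y)"]) (use assms in auto)

text \<open>Two distinct points keep the infimum from being empty, and W1 is nonnegative, so the
  curvature is at most 1 and hence real.\<close>

lemma contracting_random_walk_ricci:
  fixes m :: "'a::polish_space \<Rightarrow> 'a measure"
  assumes walk: "mrw_space m" and ricci: "0 < ricci_curv m" and ne: "a \<noteq> (b :: 'a)"
  obtains \<kappa> where "ricci_curv m = ereal \<kappa>" "contracting_random_walk m \<kappa>"
proof -
  interpret random_walk m by standard (rule walk)
  have quot: "0 \<le> W1 (m x) (m y) / ereal (dist x y)" if "x \<noteq> y" for x y
    using W1_nonneg[of "m x" "m y"] that by (cases "W1 (m x) (m y)") auto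
  have le1: "1 - W1 (m x) (m y) / ereal (dist x y) \<le> 1" if "x \<noteq> y" for x y
    using quot[OF that] by (cases "W1 (m x) (m y) / ereal (dist x y)") (auto simp: one_ereal_def)
  have "ricci_curv m \<le> 1" using ricci_curv_le[OF ne] le1[OF ne] by (rule order_trans)
  then obtain \<kappa> where \<kappa>: "ricci_curv m = ereal \<kappa>" "0 < \<kappa>" "\<kappa> \<le> 1"
    using ricci by (cases "ricci_curv m") (auto simp: one_ereal_def zero_ereal_def)
  have "W1 (m x) (m y) \<le> ereal ((1 - \<kappa>) * dist x y)" for x y
  proof (cases "x = y")
    case True
    have "W1 (m x) (m x) \<le> ereal 0"
      by (rule W1_le_of_lipschitz_bound[OF prob_step prob_step sets_step sets_step integrable_dist_step integrable_dist_step]) simp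
    then show ?thesis using True by simp
  next
    case False
    then have d: "0 < dist x y" by simp
    show ?thesis
    proof (cases "W1 (m x) (m y)")
      case (real w)
      then have "ereal \<kappa> \<le> 1 - ereal (w / dist x y)"
        using ricci_curv_le[OF False, of m] \<kappa>(1) d by simp
      then have "\<kappa> \<le> 1 - w / dist x y" by (simp add: one_ereal_def)
      then have "w \<le> (1 - \<kappa>) * dist x y" using d by (simp add: field_simps)
      then show ?thesis using real by simp
    next
      \<comment> \<open>An infinite W1 would push the curvature to minus infinity.\<close>
      case PInf
      then show ?thesis
        using ricci_curv_le[OF False, of m] \<kappa>(1) d by (simp add: one_ereal_def)
    next
      case MInf
      then show ?thesis by simp
    qed
  qed
  then have "contracting_random_walk m \<kappa>" using \<kappa> by unfold_locales auto
  then show ?thesis using that \<kappa>(1) by blast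
qed

lemma ennreal_two_times_half: "2 * ((1 / 2) * x) = (x :: ennreal)"
  using ennreal_mult_divide_eq[of 2 x]
  by (simp add: ennreal_divide_times mult.assoc[symmetric] ennreal_times_divide mult.commute[of 2])

lemma Theta_finite:
  fixes m :: "'a::polish_space \<Rightarrow> 'a measure"
  assumes "prob_space \<nu>" "Theta m \<nu> < \<infinity>"
  obtains \<Theta> where "Theta m \<nu> = ereal \<Theta>" "0 \<le> \<Theta>"
    "AE x in \<nu>. (\<integral>\<^sup>+y. ennreal ((dist x y)\<^sup>2) \<partial>m x) \<le> ennreal (2 * \<Theta>)"
proof -
  interpret prob_space \<nu> by fact
  define N where "N = (\<lambda>x. \<integral>\<^sup>+y. ennreal ((dist x y)\<^sup>2) \<partial>m x)"
  have AE: "AE x in \<nu>. enn2ereal ((1 / 2) * N x) \<le> Theta m \<nu>"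
    unfolding Theta_def N_def by (rule esssup_AE)
  have "AE x in \<nu>. 0 \<le> Theta m \<nu>"
    using AE by eventually_elim (rule order_trans[OF enn2ereal_nonneg])
  \<comment> \<open>A statement free of \<open>x\<close> that holds almost everywhere holds
    outright, as \<open>\<nu>\<close> has mass 1.\<close>
  then have "0 \<le> Theta m \<nu>" by simp
  then obtain \<Theta> where \<Theta>: "Theta m \<nu> = ereal \<Theta>" "0 \<le> \<Theta>"
    using assms(2) by (cases "Theta m \<nu>") (auto simp: zero_ereal_def)
  have "AE x in \<nu>. N x \<le> ennreal (2 * \<Theta>)"
    using AE
  proof eventually_elim
    case (elim x)
    have "enn2ereal ((1 / 2) * N x) \<le> enn2ereal (ennreal \<Theta>)"
      using elim \<Theta> by (simp add: enn2ereal_ennreal)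
    then have "(1 / 2) * N x \<le> ennreal \<Theta>" by (simp only: less_eq_ennreal.rep_eq)
    then have "2 * ((1 / 2) * N x) \<le> 2 * ennreal \<Theta>" by (rule mult_left_mono) simp
    moreover have "2 * ennreal \<Theta> = ennreal (2 * \<Theta>)" using \<Theta>(2) by (simp add: ennreal_mult)
    ultimately show ?case by (simp only: ennreal_two_times_half)
  qed
  then show ?thesis using that \<Theta> unfolding N_def by blast
qed

theorem theorem3p28:
  fixes m :: "'a::polish_space \<Rightarrow> 'a measure" and \<nu> :: "'a measure"
  assumes "mrw_space m"
    and "prob_space \<nu>"
    and "invariant_measure m \<nu>"
    and "reversible_measure m \<nu>"
    and "Theta m \<nu> < \<infinity>"
    and "ricci_curv m > 0"
  shows "\<forall>\<mu>. prob_space \<mu> \<and> sets \<mu> = sets borel \<and> absolutely_continuous \<nu> \<mu> \<longrightarrow>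
           W1 \<mu> \<nu> \<le> esqrt (2 * Theta m \<nu>) / ricci_curv m * esqrt (enn2ereal (fisher_info m \<nu> \<mu>))"
proof (intro allI impI, elim conjE)
  fix \<mu> :: "'a measure"
  assume \<mu>: "prob_space \<mu>" and s\<mu>: "sets \<mu> = sets borel" and ac: "absolutely_continuous \<nu> \<mu>"
  interpret reversible_random_walk m \<nu>
    by (intro reversible_random_walk.intro random_walk.intro reversible_random_walk_axioms.intro assms)
  interpret \<mu>: prob_space \<mu> by fact
  interpret \<nu>: prob_space \<nu> by fact
  obtain \<Theta> where \<Theta>: "Theta m \<nu> = ereal \<Theta>" "0 \<le> \<Theta>"
    "AE x in \<nu>. (\<integral>\<^sup>+y. ennreal ((dist x y)\<^sup>2) \<partial>m x) \<le> ennreal (2 * \<Theta>)"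
    using Theta_finite[OF assms(2,5)] by blast
  have sqrt\<Theta>: "esqrt (2 * Theta m \<nu>) = ereal (sqrt (2 * \<Theta>))" using \<Theta> by (simp add: esqrt_def)
  show "W1 \<mu> \<nu> \<le> esqrt (2 * Theta m \<nu>) / ricci_curv m * esqrt (enn2ereal (fisher_info m \<nu> \<mu>))"
  \<comment> \<open>In a one-point space the curvature is an infimum over the empty set, so
    infinite. The right side is then 0, and the real-valued argument has no \<open>\<kappa>\<close>
    to use.\<close>
  proof (cases "\<forall>x y :: 'a. x = y")
    case True
    then have "W1 \<mu> \<nu> = 0" using W1_subsingleton[OF _ \<mu> prob_\<nu> s\<mu> sets_\<nu>] by blast
    moreover have "{p :: 'a \<times> 'a. fst p \<noteq> snd p} = {}" using True by auto
    then have "ricci_curv m = \<infinity>" unfolding ricci_curv_def by (simp add: top_ereal_def)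
    ultimately show ?thesis by (simp add: sqrt\<Theta>)
  next
    case False
    then obtain \<kappa> where ric: "ricci_curv m = ereal \<kappa>" and "contracting_random_walk m \<kappa>"
      using contracting_random_walk_ricci[OF assms(1,6)] by blast
    interpret contracting_random_walk m \<kappa> by fact
    define f where "f = (\<lambda>x. enn2real (RN_deriv \<nu> \<mu> x))"
    have f[measurable]: "f \<in> borel_measurable borel" "0 \<le> f x" for x
      using borel_measurable_RN_deriv[of \<nu> \<mu>] by (simp_all add: f_def)
    have RN: "density \<nu> (RN_deriv \<nu> \<mu>) = \<mu>"
      using ac s\<mu> by (intro \<nu>.density_RN_deriv) auto
    have "AE x in \<nu>. RN_deriv \<nu> \<mu> x \<noteq> \<infinity>"
      using ac s\<mu> by (intro \<nu>.RN_deriv_finite) (auto intro: \<mu>.sigma_finite_measure_axioms)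
    then have "AE x in \<nu>. RN_deriv \<nu> \<mu> x = ennreal (f x)"
      by eventually_elim (simp add: f_def less_top)
    then have "density \<nu> (RN_deriv \<nu> \<mu>) = density \<nu> (\<lambda>x. ennreal (f x))"
      by (intro density_cong) auto
    then have dens: "\<mu> = density \<nu> (\<lambda>x. ennreal (f x))" by (simp add: RN)
    have f1: "(\<integral>\<^sup>+x. ennreal (f x) \<partial>\<nu>) = 1"
      using \<mu>.emeasure_space_1 by (subst (asm) (1) dens) (simp add: emeasure_density dens)
    define E where "E = (\<integral>\<^sup>+x. (\<integral>\<^sup>+y. ennreal ((sqrt (f y) - sqrt (f x))\<^sup>2) \<partial>m x) \<partial>\<nu>)"
    have "\<exists>f\<in>borel_measurable \<nu>. \<mu> = density \<nu> f"
      using RN borel_measurable_RN_deriv by metis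
    then have "fisher_info m \<nu> \<mu> = 2 * ((1 / 2) * E)"
      by (simp add: fisher_info_def H_energy_def E_def f_def)
    also have "\<dots> = E" by (rule ennreal_two_times_half)
    finally have fisher: "fisher_info m \<nu> \<mu> = E" .
    \<comment> \<open>The information is always finite, at most 4: (sqrt a - sqrt b)^2 \<le> 2 a + 2
      b, and \<open>f\<close> integrates to 1 at both ends of an edge.\<close>
    have "E = (\<integral>\<^sup>+r. ennreal ((sqrt (f (snd r)) - sqrt (f (fst r)))\<^sup>2) \<partial>edges)"
      unfolding E_def by (subst nn_integral_edges) auto
    also have "\<dots> \<le> (\<integral>\<^sup>+r. ennreal 2 * ennreal (f (fst r)) + ennreal 2 * ennreal (f (snd r)) \<partial>edges)"
    proof (rule nn_integral_mono)
      fix r :: "'a \<times> 'a"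
      have "(sqrt (f (snd r)) - sqrt (f (fst r)))\<^sup>2 = f (snd r) + f (fst r) - 2 * (sqrt (f (snd r)) * sqrt (f (fst r)))"
        using f(2) by (simp add: power2_diff)
      moreover have "0 \<le> sqrt (f (snd r)) * sqrt (f (fst r))" using f(2) by simp
      ultimately have "(sqrt (f (snd r)) - sqrt (f (fst r)))\<^sup>2 \<le> 2 * f (fst r) + 2 * f (snd r)"
        using f(2)[of "fst r"] f(2)[of "snd r"] by linarith
      then have "ennreal ((sqrt (f (snd r)) - sqrt (f (fst r)))\<^sup>2) \<le> ennreal (2 * f (fst r) + 2 * f (snd r))"
        by (rule ennreal_leI)
      also have "\<dots> = ennreal 2 * ennreal (f (fst r)) + ennreal 2 * ennreal (f (snd r))"
        using f(2) by (subst ennreal_plus, simp, simp, (subst ennreal_mult, simp, simp)+, simp)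
      finally show "ennreal ((sqrt (f (snd r)) - sqrt (f (fst r)))\<^sup>2)
          \<le> ennreal 2 * ennreal (f (fst r)) + ennreal 2 * ennreal (f (snd r))" .
    qed
    also have "\<dots> = ennreal 2 * (\<integral>\<^sup>+r. ennreal (f (fst r)) \<partial>edges) + ennreal 2 * (\<integral>\<^sup>+r. ennreal (f (snd r)) \<partial>edges)"
      by (simp add: nn_integral_add nn_integral_cmult del: ennreal_numeral)
    also have "\<dots> < \<infinity>"
      using nn_integral_edges_fst[of "\<lambda>x. ennreal (f x)"] nn_integral_edges_snd[of "\<lambda>x. ennreal (f x)"] f1 by simp
    finally obtain I where I: "E = ennreal I" "0 \<le> I" by (cases E) auto
    have sqrtI: "esqrt (enn2ereal (fisher_info m \<nu> \<mu>)) = ereal (sqrt I)"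
      using I by (simp add: fisher esqrt_def enn2ereal_ennreal)
    have "drift_le \<mu> (sqrt (2 * \<Theta>) * sqrt I)"
      unfolding dens using f f1 \<Theta>(2,3) I by (intro drift_le_energy) (auto simp: E_def)
    moreover have "drift_le \<nu> 0"
    proof -
      \<comment> \<open>\<open>\<nu>\<close> has density 1 with respect to itself; its energy
        vanishes, so the energy estimate with \<open>I = 0\<close> yields drift 0.\<close>
      have "drift_le (density \<nu> (\<lambda>x. ennreal 1)) (sqrt (2 * \<Theta>) * sqrt 0)"
        using \<Theta>(2,3) by (intro drift_le_energy) (auto simp: \<nu>.emeasure_space_1[simplified])
      then show ?thesis by (simp add: density_1)
    qed
    ultimately have "W1 \<mu> \<nu> \<le> ereal (sqrt (2 * \<Theta>) * sqrt I / \<kappa>)"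
      by (rule W1_le_of_drift[OF \<mu> prob_\<nu> s\<mu> sets_\<nu>])
    also have "\<dots> = esqrt (2 * Theta m \<nu>) / ricci_curv m * esqrt (enn2ereal (fisher_info m \<nu> \<mu>))"
      unfolding sqrt\<Theta> sqrtI ric using \<kappa>(1) by simp
    finally show ?thesis .
  qed
qed

end
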